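(* Let $\alpha\in\mathbb N$. For any $q>1$ there exists a function $f\in L_1(\mathbb T)$ such that there is no constant $C$, independent of $n$, for which $$\omega_\alpha(f,2^{-n})_{L_1(\mathbb T)}\le C\Big(\sum_{k=n+1}^\infty2^{-q\alpha k}\|(\eta_{2^k}f)^{(\alpha)}\|_{L_1(\mathbb T)}^q\Big)^{1/q}$$ holds for all $n\in\mathbb N$.
   Context: $\mathbb T=[0,2\pi]$. The de la Vallée Poussin means are $\eta_Nf(x)=\sum_{k\in\mathbb Z}\eta(|k|/N)\widehat f(k)e^{ikx}$, where $\eta\in C^\infty[0,\infty)$, $\eta(\xi)=1$ for $\xi\le1/2$, $\eta(\xi)=0$ for $\xi\ge1$, and $\widehat f(k)=\frac1{2\pi}\int_{\mathbb T}f(y)e^{-iky}dy$. For $\alpha\in\mathbb N$, $\omega_\alpha(f,\delta)_{L_1(\mathbb T)}=\sup_{|h|\le\delta}\|\Delta_h^\alpha f\|_{L_1(\mathbb T)}$ with $\Delta_hf(x)=f(x+h)-f(x)$, $\Delta_h^\alpha=\Delta_h\Delta_h^{\alpha-1}$. *)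

theory Defs
  imports "HOL-Analysis.Analysis"
begin

text \<open>
  Functions on the circle are functions on the real line of period $2\pi$, so that the translates
  \<open>f (x + h)\<close> make sense; integrals are taken over one period.
\<close>

definition L1_torus :: "(real \<Rightarrow> complex) set" where
  "L1_torus = {f. (\<forall>x. f (x + 2 * pi) = f x) \<and> set_integrable lborel {0..2 * pi} f}"

definition L1_norm :: "(real \<Rightarrow> complex) \<Rightarrow> ennreal" where
  "L1_norm f = (\<integral>\<^sup>+x\<in>{0..2 * pi}. ennreal (norm (f x)) \<partial>lborel)"

definition fourier_coeff :: "(real \<Rightarrow> complex) \<Rightarrow> int \<Rightarrow> complex" where
  "fourier_coeff f k =
     1 / (2 * pi) * (LINT y:{0..2 * pi}|lborel. f y * exp (- (\<i> * of_int k * of_real y)))"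

text \<open>Derivatives are those within the half-line, hence one-sided at \<open>0\<close>.\<close>

definition smooth_on_half_line :: "(real \<Rightarrow> real) \<Rightarrow> bool" where
  "smooth_on_half_line g \<longleftrightarrow>
     (\<exists>D :: nat \<Rightarrow> real \<Rightarrow> real.
        (\<forall>x\<ge>0. D 0 x = g x) \<and>
        (\<forall>m. \<forall>x\<ge>0. (D m has_real_derivative D (Suc m) x) (at x within {0..})))"

definition vp_cutoff :: "(real \<Rightarrow> real) \<Rightarrow> bool" where
  "vp_cutoff \<eta> \<longleftrightarrow>
     smooth_on_half_line \<eta> \<and> (\<forall>x. 0 \<le> x \<and> x \<le> 1/2 \<longrightarrow> \<eta> x = 1) \<and> (\<forall>x\<ge>1. \<eta> x = 0)"

text \<open>For a cutoff \<open>\<eta>\<close> only the terms with $|k| < N$ are nonzero.\<close>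

definition vp_mean :: "(real \<Rightarrow> real) \<Rightarrow> nat \<Rightarrow> (real \<Rightarrow> complex) \<Rightarrow> real \<Rightarrow> complex" where
  "vp_mean \<eta> N f x =
     (\<Sum>\<^sub>\<infinity>k\<in>(UNIV :: int set).
        of_real (\<eta> (of_int \<bar>k\<bar> / of_nat N)) * fourier_coeff f k * exp (\<i> * of_int k * of_real x))"

definition nth_derivative :: "nat \<Rightarrow> (real \<Rightarrow> complex) \<Rightarrow> real \<Rightarrow> complex" where
  "nth_derivative m = (\<lambda>g x. vector_derivative g (at x)) ^^ m"

definition fwd_diff :: "real \<Rightarrow> (real \<Rightarrow> complex) \<Rightarrow> real \<Rightarrow> complex" where
  "fwd_diff h f x = f (x + h) - f x"

definition modulus_smoothness :: "nat \<Rightarrow> (real \<Rightarrow> complex) \<Rightarrow> real \<Rightarrow> ennreal" where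
  "modulus_smoothness \<alpha> f \<delta> = (SUP h\<in>{h. \<bar>h\<bar> \<le> \<delta>}. L1_norm ((fwd_diff h ^^ \<alpha>) f))"

text \<open>
  Powers of extended nonnegative reals, meant for exponents \<open>p > 0\<close> only. They let a divergent
  series on the right-hand side of the inequality count as \<open>\<infinity>\<close>.
\<close>

definition ennreal_powr :: "ennreal \<Rightarrow> real \<Rightarrow> ennreal" where
  "ennreal_powr x p = (if x = \<infinity> then \<infinity> else ennreal (enn2real x powr p))"

end

theory Submission
  imports Defs
begin

text \<open>
  Take $f = \sum_j (j+1)^{-2} f_j$ with $f_j(x) = 2^j \psi(2^j x)$, where \<open>\<psi>\<close> is the derivative of a bump
  supported in $[1,2]$. The supports are disjoint and \<open>f\<close> vanishes to the left of \<open>0\<close>, so the modulus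
  at $2^{-n}$ is at least $\int_0^{2^{-n}} |f|$, a sum of norms of order $\sum_{j>n} j^{-2} \sim 1/n$.
  On the other side, $f_j$ is both a derivative of a function of norm $\lesssim 2^{-j}$ and a function
  whose derivative has norm $\lesssim 2^j$, so Bernstein's inequality for the means gives
  $2^{-\alpha k} \|(\eta_{2^k} f_j)^{(\alpha)}\|_1 \lesssim 2^{-|k-j|}$. Hence the \<open>k\<close>-th term
  is $\lesssim k^{-2q}$ and the right-hand side is of order $n^{1/q-2}$, which is $o(1/n)$ as $q > 1$.
\<close>

section \<open>Second differences and the kernel estimate\<close>

text \<open>What defeats an exponent q > 1 is that pieces with disjoint supports have L1 norms that
  simply add: the modulus sees an l^1 sum over the scales, the right-hand side an l^q sum of the
  same quantities. The separation has to be in space. A lacunary trigonometric series has L1 norm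
  comparable to an l^2 sum of its coefficients and could refute only q > 2. The price is that a
  piece concentrated near 0 is not band-limited and is met by every mean. Its contribution must
  decay on both sides of the matching scale, so a piece has to be a derivative and to have a
  derivative; this is why \<psi> is the derivative of a twice differentiable bump. The weight
  (j+1)^{-2} is summable, yet its tails are of order n^{-1} in l^1 and n^{1/q-2} in l^q, which
  differ for every q > 1. Hence one and the same f serves for all \<eta>, \<alpha> and q.\<close>

lemma smooth_on_half_line_mult_id:
  assumes "smooth_on_half_line g"
  shows "smooth_on_half_line (\<lambda>x. x * g x)"
proof -
  obtain D where D0: "\<And>x. x \<ge> 0 \<Longrightarrow> D 0 x = g x"
    and D: "\<And>m x. x \<ge> 0 \<Longrightarrow> (D m has_real_derivative D (Suc m) x) (at x within {0..})"
    using assms unfolding smooth_on_half_line_def by blast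
  \<comment> \<open>Leibniz' rule for the derivatives of x * g. At m = 0 the truncated index m - 1
    does no harm, as its factor is 0.\<close>
  define E where "E = (\<lambda>m x. x * D m x + real m * D (m - 1) x)"
  have "(E m has_real_derivative E (Suc m) x) (at x within {0..})" if "x \<ge> 0" for m x
  proof (cases m)
    case 0
    show ?thesis unfolding E_def 0
      by (auto intro!: derivative_eq_intros D[OF that])
  next
    case (Suc l)
    show ?thesis unfolding E_def Suc
      by (auto intro!: derivative_eq_intros D[OF that] simp: algebra_simps)
  qed
  moreover have "E 0 x = x * g x" if "x \<ge> 0" for x
    using D0[OF that] by (simp add: E_def)
  ultimately show ?thesis
    unfolding smooth_on_half_line_def by blast
qed

lemma smooth_on_half_line_mult_power:
  assumes "smooth_on_half_line g"
  shows "smooth_on_half_line (\<lambda>x. x ^ m * g x)"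
proof (induction m)
  case 0
  then show ?case using assms by simp
next
  case (Suc m)
  from smooth_on_half_line_mult_id[OF Suc] show ?case
    by (simp add: mult_ac)
qed

lemma smooth_on_half_line_continuous_on:
  assumes "smooth_on_half_line g"
  shows "continuous_on {0..} g"
proof -
  obtain D where D0: "\<And>x. x \<ge> 0 \<Longrightarrow> D 0 x = g x"
    and D: "\<And>m x. x \<ge> 0 \<Longrightarrow> (D m has_real_derivative D (Suc m) x) (at x within {0..})"
    using assms unfolding smooth_on_half_line_def by blast
  have "continuous_on {0..} (D 0)"
    by (auto simp: continuous_on_eq_continuous_within intro!: DERIV_continuous[OF D])
  then show ?thesis
    by (rule continuous_on_eq) (use D0 in auto)
qed

text \<open>Two mean value steps: the second difference is an increment of the first difference
  \<open>u\<close>, hence h^2 times a value of the second derivative. The condition h \<le> x keeps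
  all points in the half-line, and R keeps them in a compact interval, where the second derivative
  is bounded.\<close>

lemma smooth_on_half_line_second_difference:
  assumes "smooth_on_half_line g"
  obtains M where "M \<ge> 0"
    and "\<And>x h. 0 \<le> h \<Longrightarrow> h \<le> x \<Longrightarrow> x + h \<le> R \<Longrightarrow> \<bar>g (x + h) - 2 * g x + g (x - h)\<bar> \<le> M * h\<^sup>2"
proof -
  obtain D where D0: "\<And>x. x \<ge> 0 \<Longrightarrow> D 0 x = g x"
    and D: "\<And>m x. x \<ge> 0 \<Longrightarrow> (D m has_real_derivative D (Suc m) x) (at x within {0..})"
    using assms unfolding smooth_on_half_line_def by blast
  have "continuous_on {0..} (D 2)"
    by (auto simp: continuous_on_eq_continuous_within intro!: DERIV_continuous[OF D])
  then have "continuous_on {0..R} (D 2)"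
    by (rule continuous_on_subset) auto
  then have "bounded (D 2 ` {0..R})"
    by (intro compact_imp_bounded compact_continuous_image) auto
  then obtain M where M: "M > 0" "\<And>x. 0 \<le> x \<Longrightarrow> x \<le> R \<Longrightarrow> \<bar>D 2 x\<bar> \<le> M"
    unfolding bounded_pos by auto
  have "\<bar>g (x + h) - 2 * g x + g (x - h)\<bar> \<le> M * h\<^sup>2"
    if h: "0 \<le> h" "h \<le> x" "x + h \<le> R" for x h
  proof (cases "h = 0")
    case True
    then show ?thesis by simp
  next
    case False
    then have hp: "h > 0" using h by simp
    define u where "u = (\<lambda>s. D 0 (s + h) - D 0 s)"
    have Dw: "(D m has_real_derivative D (Suc m) y) (at y within {a..b})" if "0 \<le> a" "y \<ge> a" for m y a b
      by (rule has_field_derivative_subset[OF D]) (use that in auto)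
    have du: "(u has_real_derivative (D 1 (s + h) - D 1 s)) (at s within {x - h..x})" if "s \<ge> x - h" for s
    proof -
      have "((D 0 \<circ> (\<lambda>s. s + h)) has_real_derivative D (Suc 0) (s + h) * 1) (at s within {x - h..x})"
        by (rule DERIV_image_chain[OF has_field_derivative_subset[OF D]])
          (use that h in \<open>auto intro!: derivative_eq_intros\<close>)
      then show ?thesis
        unfolding u_def using Dw[of "x - h" s 0 x] that h
        by (auto intro!: derivative_eq_intros simp: o_def)
    qed
    obtain c where c: "c \<in> {x - h<..<x}" "u x - u (x - h) = (x - (x - h)) * (D 1 (c + h) - D 1 c)"
      using mvt_simple[of "x - h" x u "\<lambda>s t. t * (D 1 (s + h) - D 1 s)"] du hp
      by (auto simp: has_field_derivative_def mult_commute_abs)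
    obtain d where d: "d \<in> {c<..<c + h}" "D 1 (c + h) - D 1 c = (c + h - c) * D 2 d"
      using mvt_simple[of c "c + h" "D 1" "\<lambda>s t. t * D 2 s"] Dw[of c _ 1 "c + h"] hp c h
      by (auto simp: has_field_derivative_def mult_commute_abs numeral_2_eq_2)
    have "g (x + h) - 2 * g x + g (x - h) = u x - u (x - h)"
      using D0 h by (simp add: u_def)
    also have "\<dots> = h\<^sup>2 * D 2 d"
      using c d by (simp add: power2_eq_square)
    also have "\<bar>\<dots>\<bar> \<le> h\<^sup>2 * M"
      unfolding abs_mult using c d h by (intro mult_mono M(2)) auto
    finally show ?thesis by (simp add: mult.commute)
  qed
  then show ?thesis using M(1) that[of M] by simp
qed

lemma jordan_sin_lower:
  assumes "0 \<le> x" "x \<le> pi / 2"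
  shows "2 / pi * x \<le> sin x"
proof -
  have "convex_on {0..pi/2} (\<lambda>x. - sin x)"
    by (rule f''_ge0_imp_convex[where f' = "\<lambda>x. - cos x" and f'' = sin])
      (auto intro!: derivative_eq_intros sin_ge_zero)
  from convex_onD[OF this, of "2 * x / pi" 0 "pi / 2"] assms
  show ?thesis by (auto simp: divide_simps split: if_splits)
qed

text \<open>Since 2 - 2 cos t = 4 (sin (t/2))^2, Jordan's inequality suffices; pi < 4 turns its
  constant into a rational one.\<close>

lemma two_minus_two_cos_ge:
  assumes "\<bar>t\<bar> \<le> pi"
  shows "t\<^sup>2 / 4 \<le> 2 - 2 * cos t"
proof -
  have "\<bar>t\<bar> / 4 \<le> 2 / pi * (\<bar>t\<bar> / 2)"
    using pi_less_4 by (simp add: divide_simps mult_left_mono)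
  also have "\<dots> \<le> sin (\<bar>t\<bar> / 2)"
    by (rule jordan_sin_lower) (use assms in auto)
  finally have "(\<bar>t\<bar> / 4)\<^sup>2 \<le> (sin (\<bar>t\<bar> / 2))\<^sup>2"
    by (intro power_mono) auto
  also have "(sin (\<bar>t\<bar> / 2))\<^sup>2 = (2 - 2 * cos t) / 4"
    using cos_double_sin[of "\<bar>t\<bar> / 2"] by (simp add: cos_abs_real)
  finally show ?thesis by (simp add: power_divide)
qed

text \<open>Summation by parts, twice at once: the factor is 2 - e^{it} - e^{-it}, and
  multiplication by an exponential shifts the coefficients by one. They vanish already at k = M and
  k = -M, so the shifts lose nothing at the ends of the window.\<close>

lemma trig_sum_second_difference:
  fixes c :: "int \<Rightarrow> complex"
  assumes "\<And>k. \<bar>k\<bar> \<ge> M \<Longrightarrow> c k = 0"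
  shows "of_real (2 - 2 * cos t) * (\<Sum>k\<in>{-M..M}. c k * exp (\<i> * of_int k * of_real t))
    = - (\<Sum>k\<in>{-M..M}. (c (k + 1) - 2 * c k + c (k - 1)) * exp (\<i> * of_int k * of_real t))"
proof -
  let ?e = "\<lambda>k::int. exp (\<i> * of_int k * of_real t)"
  have up: "(\<Sum>k\<in>{-M..M}. c k * ?e (k - 1)) = (\<Sum>k\<in>{-M..M}. c (k + 1) * ?e k)"
  proof -
    have "(\<Sum>k\<in>{-M..M}. c (k + 1) * ?e k) = (\<Sum>k\<in>{-M+1..M+1}. c k * ?e (k - 1))"
      by (rule sum.reindex_bij_witness[of _ "\<lambda>k. k - 1" "\<lambda>k. k + 1"]) auto
    also have "\<dots> = (\<Sum>k\<in>{-M..M+1}. c k * ?e (k - 1))"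
      by (rule sum.mono_neutral_left) (use assms in auto)
    also have "\<dots> = (\<Sum>k\<in>{-M..M}. c k * ?e (k - 1))"
      by (rule sum.mono_neutral_right) (use assms in auto)
    finally show ?thesis by simp
  qed
  have down: "(\<Sum>k\<in>{-M..M}. c k * ?e (k + 1)) = (\<Sum>k\<in>{-M..M}. c (k - 1) * ?e k)"
  proof -
    have "(\<Sum>k\<in>{-M..M}. c (k - 1) * ?e k) = (\<Sum>k\<in>{-M-1..M-1}. c k * ?e (k + 1))"
      by (rule sum.reindex_bij_witness[of _ "\<lambda>k. k + 1" "\<lambda>k. k - 1"]) auto
    also have "\<dots> = (\<Sum>k\<in>{-M-1..M}. c k * ?e (k + 1))"
      by (rule sum.mono_neutral_left) (use assms in auto)
    also have "\<dots> = (\<Sum>k\<in>{-M..M}. c k * ?e (k + 1))"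
      by (rule sum.mono_neutral_right) (use assms in auto)
    finally show ?thesis by simp
  qed
  have cs: "of_real (2 - 2 * cos t) * ?e k = 2 * ?e k - ?e (k + 1) - ?e (k - 1)" for k
  proof -
    have "?e (k + 1) = ?e k * exp (\<i> * t)" "?e (k - 1) = ?e k * exp (- (\<i> * t))"
      by (simp_all add: exp_add[symmetric] algebra_simps)
    moreover have "of_real (2 * cos t) = exp (\<i> * t) + exp (- (\<i> * t))"
      by (simp add: cos_of_real[symmetric] cos_exp_eq)
    ultimately show ?thesis by (simp add: algebra_simps)
  qed
  have "of_real (2 - 2 * cos t) * (\<Sum>k\<in>{-M..M}. c k * ?e k)
    = (\<Sum>k\<in>{-M..M}. c k * (of_real (2 - 2 * cos t) * ?e k))"
    by (simp only: sum_distrib_left mult_ac)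
  also have "\<dots> = (\<Sum>k\<in>{-M..M}. 2 * (c k * ?e k)) - (\<Sum>k\<in>{-M..M}. c k * ?e (k + 1))
      - (\<Sum>k\<in>{-M..M}. c k * ?e (k - 1))"
    unfolding cs sum_subtractf[symmetric] by (simp add: algebra_simps)
  also have "\<dots> = - (\<Sum>k\<in>{-M..M}. (c (k + 1) - 2 * c k + c (k - 1)) * ?e k)"
    unfolding up down sum_subtractf[symmetric] sum_negf[symmetric] by (simp add: algebra_simps)
  finally show ?thesis .
qed

text \<open>The trivial bound is good for |t| \<le> 1/N, the second differences gain a factor
  (Nt)^{-2} beyond. Together they give a majorant whose integral is bounded independently of N.
  There are 2N + 1 \<le> 3N terms, so the two constants are 3 and 4 * 3 = 12, in total 15.\<close>

lemma trig_sum_kernel_bound: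
  fixes c :: "int \<Rightarrow> complex" and N :: nat
  assumes N: "N \<ge> 1" and supp: "\<And>k. \<bar>k\<bar> \<ge> int N \<Longrightarrow> c k = 0"
    and A: "\<And>k. norm (c k) \<le> A"
    and B: "\<And>k. norm (c (k + 1) - 2 * c k + c (k - 1)) \<le> A / (real N)\<^sup>2"
    and t: "\<bar>t\<bar> \<le> pi"
  shows "norm (\<Sum>k\<in>{-int N..int N}. c k * exp (\<i> * of_int k * of_real t))
    \<le> 15 * A * (real N / (1 + (real N * t)\<^sup>2))"
proof -
  let ?S = "\<Sum>k\<in>{-int N..int N}. c k * exp (\<i> * of_int k * of_real t)"
  have A0: "A \<ge> 0" using A[of 0] norm_ge_zero order_trans by blast
  have card: "real (card {-int N..int N}) \<le> 3 * real N"
    using N by simp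
  have nexp: "norm (exp (\<i> * of_int k * complex_of_real t)) = 1" for k
    by (simp add: norm_exp_eq_Re)
  have 1: "norm ?S \<le> 3 * real N * A"
  proof -
    have "norm ?S \<le> (\<Sum>k\<in>{-int N..int N}. A)"
      by (intro sum_norm_le) (simp add: norm_mult nexp A)
    also have "\<dots> \<le> 3 * real N * A"
      using card A0 by (simp only: sum_constant mult_right_mono)
    finally show ?thesis .
  qed
  have 2: "(2 - 2 * cos t) * norm ?S \<le> 3 * real N * (A / (real N)\<^sup>2)"
  proof -
    have "(2 - 2 * cos t) * norm ?S = norm (of_real (2 - 2 * cos t) * ?S)"
      using cos_le_one[of t] unfolding norm_mult norm_of_real by simp
    also have "\<dots> \<le> (\<Sum>k\<in>{-int N..int N}. A / (real N)\<^sup>2)"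
      by (subst trig_sum_second_difference, erule supp, subst norm_minus_cancel, intro sum_norm_le)
        (simp only: norm_mult nexp B mult_1_right)
    also have "\<dots> \<le> 3 * real N * (A / (real N)\<^sup>2)"
      using card A0 unfolding sum_constant by (intro mult_right_mono) auto
    finally show ?thesis .
  qed
  have "t\<^sup>2 / 4 * norm ?S \<le> (2 - 2 * cos t) * norm ?S"
    by (intro mult_right_mono two_minus_two_cos_ge t) auto
  with 2 have "t\<^sup>2 / 4 * norm ?S \<le> 3 * real N * (A / (real N)\<^sup>2)" by linarith
  then have "(real N)\<^sup>2 * (t\<^sup>2 / 4 * norm ?S) \<le> (real N)\<^sup>2 * (3 * real N * (A / (real N)\<^sup>2))"
    by (intro mult_left_mono) auto
  then have "(real N * t)\<^sup>2 * norm ?S \<le> 12 * real N * A"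
    using N by (simp add: power_mult_distrib)
  with 1 have "(1 + (real N * t)\<^sup>2) * norm ?S \<le> 15 * A * real N"
    by (simp add: algebra_simps)
  moreover have "1 + (real N * t)\<^sup>2 > 0"
    by (simp add: add_pos_nonneg)
  ultimately show ?thesis
    by (simp add: pos_le_divide_eq mult.commute)
qed

text \<open>For k \<ge> 1 the coefficients are samples of the smooth function \<open>g\<close>, and
  parity reduces k \<le> -1 to this. Only k = 0 is delicate, since the even or odd extension of
  \<open>g\<close> might have a kink there; the flatness of \<eta> on [0, 1/2] excludes it, and N
  \<ge> 2 puts 1/N into that interval.\<close>

lemma vp_multiplier_bounds:
  assumes "vp_cutoff \<eta>"
  obtains A where
    "\<And>(N::nat) (k::int). N \<ge> 2 \<Longrightarrow> \<bar>(of_int k / real N) ^ m * \<eta> (of_int \<bar>k\<bar> / real N)\<bar> \<le> A"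
    "\<And>(N::nat) (k::int). N \<ge> 2 \<Longrightarrow>
       \<bar>(of_int (k + 1) / real N) ^ m * \<eta> (of_int \<bar>k + 1\<bar> / real N)
        - 2 * ((of_int k / real N) ^ m * \<eta> (of_int \<bar>k\<bar> / real N))
        + (of_int (k - 1) / real N) ^ m * \<eta> (of_int \<bar>k - 1\<bar> / real N)\<bar> \<le> A / (real N)\<^sup>2"
proof -
  define g where "g = (\<lambda>x. x ^ m * \<eta> x)"
  have sm: "smooth_on_half_line g" 
    using assms smooth_on_half_line_mult_power unfolding g_def vp_cutoff_def by blast
  have one: "\<eta> x = 1" if "0 \<le> x" "x \<le> 1/2" for x
    using assms that unfolding vp_cutoff_def by blast
  have zero: "\<eta> x = 0" if "x \<ge> 1" for x
    using assms that unfolding vp_cutoff_def by blast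
  obtain M where M: "M \<ge> 0"
    "\<And>x h. 0 \<le> h \<Longrightarrow> h \<le> x \<Longrightarrow> x + h \<le> 2 \<Longrightarrow> \<bar>g (x + h) - 2 * g x + g (x - h)\<bar> \<le> M * h\<^sup>2"
    using smooth_on_half_line_second_difference[OF sm, of 2] by blast
  have "continuous_on {0..1} g"
    by (rule continuous_on_subset[OF smooth_on_half_line_continuous_on[OF sm]]) auto
  then have "bounded (g ` {0..1})"
    by (intro compact_imp_bounded compact_continuous_image) auto
  then obtain L where L: "L > 0" "\<And>x. 0 \<le> x \<Longrightarrow> x \<le> 1 \<Longrightarrow> \<bar>g x\<bar> \<le> L"
    unfolding bounded_pos by auto
  have Lall: "\<bar>g x\<bar> \<le> L" if "x \<ge> 0" for x
    using L zero[of x] that by (cases "x \<le> 1") (auto simp: g_def)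
  define c where "c = (\<lambda>(N::nat) (k::int). (of_int k / real N) ^ m * \<eta> (of_int \<bar>k\<bar> / real N))"
  have c_nonneg: "c N k = g (of_int k / real N)" if "k \<ge> 0" for N k
    using that by (simp add: c_def g_def)
  have c_minus: "c N (- k) = (- 1) ^ m * c N k" for N k
    unfolding c_def by (simp add: power_mult_distrib[symmetric])
  have abs_c: "\<bar>c N (- k)\<bar> = \<bar>c N k\<bar>" for N k
    unfolding c_minus by (simp add: abs_mult power_abs)
  \<comment> \<open>L for the size, M for the second differences at k \<noteq> 0, and 2 for the
    explicit one at k = 0.\<close>
  define A where "A = L + M + 2"
  have A1: "\<bar>c N k\<bar> \<le> A" for N k
  proof -
    have "\<bar>c N k\<bar> = \<bar>c N \<bar>k\<bar>\<bar>"
      using abs_c[of N k] by (cases "k \<ge> 0") auto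
    also have "\<dots> \<le> L"
      by (subst c_nonneg) (auto intro!: Lall)
    finally show ?thesis using M by (simp add: A_def)
  qed
  have pos: "\<bar>c N (k + 1) - 2 * c N k + c N (k - 1)\<bar> \<le> A / (real N)\<^sup>2"
    if N: "N \<ge> 2" and k: "k \<ge> 1" for N k
  proof (cases "k > int N")
    \<comment> \<open>Here k - 1 \<ge> N as well, so all three coefficients vanish. Otherwise (k +
      1)/N \<le> 2, which is why M was taken on [0, 2].\<close>
    case True
    have "c N l = 0" if "l \<ge> int N" for l
    proof -
      from that have "real_of_int \<bar>l\<bar> \<ge> real N" by linarith
      then show ?thesis unfolding c_def using N by (simp add: zero)
    qed
    then show ?thesis using True M L by (simp add: A_def)
  next
    case False
    then have "real_of_int k \<le> real N" by linarith
    then have "real_of_int k + 1 \<le> 2 * real N" using N by linarith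
    then have "\<bar>g (of_int k / real N + 1 / real N) - 2 * g (of_int k / real N)
        + g (of_int k / real N - 1 / real N)\<bar> \<le> M * (1 / real N)\<^sup>2"
      using k N by (intro M(2)) (auto simp: divide_simps)
    also have "\<dots> \<le> A / (real N)\<^sup>2"
      using L M by (auto simp: power_divide A_def intro!: divide_right_mono)
    finally show ?thesis
      using k by (simp add: c_nonneg add_divide_distrib diff_divide_distrib)
  qed
  have A2: "\<bar>c N (k + 1) - 2 * c N k + c N (k - 1)\<bar> \<le> A / (real N)\<^sup>2"
    if N: "N \<ge> 2" for N k
  proof -
    consider "k \<ge> 1" | "k = 0" | "- k \<ge> 1" by linarith
    then show ?thesis
    proof cases
      case 1
      then show ?thesis using pos N by blast
    next
      case 2
      have e: "\<eta> (1 / real N) = 1" "\<eta> 0 = 1"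
        using N by (auto intro!: one simp: divide_simps)
      \<comment> \<open>For m = 0 and m = 1 the expression is 0; for m \<ge> 2 each power of 1/N is
        at most N^{-2} in absolute value.\<close>
      have "\<bar>(1 / real N) ^ m - 2 * 0 ^ m + (- 1 / real N) ^ m\<bar> \<le> 2 / (real N)\<^sup>2"
      proof -
        consider "m = 0" | "m = 1" | "m \<ge> 2" by linarith
        then show ?thesis
        proof cases
          case 3
          have "\<bar>(1 / real N) ^ m - 2 * 0 ^ m + (- 1 / real N) ^ m\<bar> \<le> 2 * (1 / real N) ^ m"
            using 3 abs_triangle_ineq[of "(1 / real N) ^ m" "(- 1 / real N) ^ m"]
            by (simp add: power_abs power_0_left)
          also have "\<dots> \<le> 2 * (1 / real N) ^ 2"
            using 3 N by (intro mult_left_mono power_decreasing) auto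
          finally show ?thesis by (simp add: power_divide)
        qed auto
      qed
      also have "\<dots> \<le> A / (real N)\<^sup>2"
        using L M by (auto simp: A_def intro!: divide_right_mono)
      finally show ?thesis using 2 e by (simp add: c_def)
    next
      case 3
      have "c N (k + 1) - 2 * c N k + c N (k - 1)
        = (- 1) ^ m * (c N (- k + 1) - 2 * c N (- k) + c N (- k - 1))"
        using c_minus[of N "- k - 1"] c_minus[of N "- k"] c_minus[of N "- k + 1"]
        by (simp add: algebra_simps)
      then have "\<bar>c N (k + 1) - 2 * c N k + c N (k - 1)\<bar>
        = \<bar>c N (- k + 1) - 2 * c N (- k) + c N (- k - 1)\<bar>"
        by (simp add: abs_mult power_abs)
      then show ?thesis using pos[OF N 3] by simp
    qed
  qed
  show ?thesis
    by (rule that[of A]) (use A1 A2 in \<open>auto simp: c_def\<close>)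
qed

section \<open>Masses of the kernels and convolution in L1\<close>

lemma nn_integral_inverse_quadratic_le:
  "(\<integral>\<^sup>+(x::real). ennreal (1 / (1 + x\<^sup>2)) \<partial>lborel) \<le> ennreal pi"
proof -
  let ?f = "\<lambda>x::real. ennreal (1 / (1 + x\<^sup>2))"
  have pos: "(\<integral>\<^sup>+x. ?f x * indicator {0..} x \<partial>lborel) = ennreal (pi / 2)"
    using nn_integral_FTC_atLeast[of "\<lambda>x. 1 / (1 + x\<^sup>2)" 0 arctan "pi / 2"]
    by (simp add: tendsto_arctan_at_top DERIV_arctan inverse_eq_divide[symmetric])
  have "(\<integral>\<^sup>+x. ?f x * indicator {0..} x \<partial>lborel) = (\<integral>\<^sup>+x. ?f x * indicator {0..} (- x) \<partial>lborel)"
    by (subst nn_integral_real_affine[of _ "- 1" 0]) simp_all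
  with pos have neg: "(\<integral>\<^sup>+x. ?f x * indicator {0..} (- x) \<partial>lborel) = ennreal (pi / 2)" by simp
  have "(\<integral>\<^sup>+x. ?f x \<partial>lborel) \<le> (\<integral>\<^sup>+x. ?f x * indicator {0..} x + ?f x * indicator {0..} (- x) \<partial>lborel)"
    by (intro nn_integral_mono) (auto simp: indicator_def)
  also have "\<dots> = ennreal (pi / 2) + ennreal (pi / 2)"
    by (subst nn_integral_add) (simp_all add: pos neg)
  also have "\<dots> = ennreal pi"
    by (subst ennreal_plus[symmetric]) simp_all
  finally show ?thesis .
qed

lemma nn_integral_scaled_inverse_quadratic_le:
  assumes "N > 0"
  shows "(\<integral>\<^sup>+(x::real). ennreal (N / (1 + (N * (x - s))\<^sup>2)) \<partial>lborel) \<le> ennreal pi"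
proof -
  have "(\<integral>\<^sup>+(x::real). ennreal (N / (1 + (N * (x - s))\<^sup>2)) \<partial>lborel)
    = (\<integral>\<^sup>+(x::real). ennreal N * ennreal (1 / (1 + (- N * s + N * x)\<^sup>2)) \<partial>lborel)"
    using assms by (intro nn_integral_cong) (simp add: ennreal_mult'[symmetric] algebra_simps)
  also have "\<dots> = ennreal N * (\<integral>\<^sup>+(x::real). ennreal (1 / (1 + (- N * s + N * x)\<^sup>2)) \<partial>lborel)"
    by (rule nn_integral_cmult) simp
  also have "\<dots> = (\<integral>\<^sup>+(x::real). ennreal (1 / (1 + x\<^sup>2)) \<partial>lborel)"
    using assms by (subst (2) nn_integral_real_affine[of _ N "- N * s"]) simp_all
  finally show ?thesis using nn_integral_inverse_quadratic_le by simp
qed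

text \<open>The difference x - y ranges over [-2 pi, 2 pi], but the bound is known on one period
  only. One of three translates of y brings the difference into it, and the sum of the three bounds
  avoids choosing which. Each contributes mass pi, hence 3 pi.\<close>

lemma nn_integral_periodic_kernel_le:
  fixes K :: "real \<Rightarrow> complex"
  assumes N: "N > 0" and B: "B \<ge> 0" and per: "\<And>t. K (t + 2 * pi) = K t"
    and bd: "\<And>t. \<bar>t\<bar> \<le> pi \<Longrightarrow> norm (K t) \<le> B * (N / (1 + (N * t)\<^sup>2))"
    and y: "0 \<le> y" "y \<le> 2 * pi"
  shows "(\<integral>\<^sup>+x\<in>{0..2 * pi}. ennreal (norm (K (x - y))) \<partial>lborel) \<le> ennreal (3 * pi * B)"
proof -
  let ?b = "\<lambda>s x. ennreal (N / (1 + (N * (x - s))\<^sup>2))"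
  have pt: "ennreal (norm (K (x - y)))
    \<le> ennreal B * (?b y x + ?b (y + 2 * pi) x + ?b (y - 2 * pi) x)"
    if x: "0 \<le> x" "x \<le> 2 * pi" for x
  proof -
    have "\<exists>s \<in> {y, y + 2 * pi, y - 2 * pi}. \<bar>x - s\<bar> \<le> pi \<and> K (x - y) = K (x - s)"
    proof -
      consider "\<bar>x - y\<bar> \<le> pi" | "x - y > pi" | "x - y < - pi" by linarith
      then show ?thesis
      proof cases
        case 1
        then show ?thesis by blast
      next
        case 2
        then show ?thesis using x y per[of "x - (y + 2 * pi)"]
          by (intro bexI[of _ "y + 2 * pi"]) auto
      next
        case 3
        then show ?thesis using x y per[of "x - y"]
          by (intro bexI[of _ "y - 2 * pi"]) (auto simp: algebra_simps)
      qed
    qed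
    then obtain s where s: "s \<in> {y, y + 2 * pi, y - 2 * pi}" "\<bar>x - s\<bar> \<le> pi" "K (x - y) = K (x - s)"
      by blast
    have "ennreal (norm (K (x - y))) \<le> ennreal (B * (N / (1 + (N * (x - s))\<^sup>2)))"
      using bd[OF s(2)] s(3) by (intro ennreal_leI) simp
    also have "\<dots> = ennreal B * ?b s x"
      using B N by (intro ennreal_mult) auto
    also have "\<dots> \<le> ennreal B * (?b y x + ?b (y + 2 * pi) x + ?b (y - 2 * pi) x)"
      using s(1) by (intro mult_left_mono) (auto simp: add_increasing add_increasing2)
    finally show ?thesis .
  qed
  have "(\<integral>\<^sup>+x\<in>{0..2 * pi}. ennreal (norm (K (x - y))) \<partial>lborel)
    \<le> (\<integral>\<^sup>+x. ennreal B * (?b y x + ?b (y + 2 * pi) x + ?b (y - 2 * pi) x) \<partial>lborel)"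
    by (intro nn_integral_mono) (auto simp: indicator_def intro: pt)
  also have "\<dots> = ennreal B * ((\<integral>\<^sup>+x. ?b y x \<partial>lborel) + (\<integral>\<^sup>+x. ?b (y + 2 * pi) x \<partial>lborel)
      + (\<integral>\<^sup>+x. ?b (y - 2 * pi) x \<partial>lborel))"
    by (simp add: nn_integral_cmult nn_integral_add)
  also have "\<dots> \<le> ennreal B * (ennreal pi + ennreal pi + ennreal pi)"
    by (intro mult_left_mono add_mono nn_integral_scaled_inverse_quadratic_le N) auto
  also have "\<dots> = ennreal (3 * pi * B)"
    using B by (simp add: ennreal_plus[symmetric] ennreal_mult'[symmetric] algebra_simps
        del: ennreal_plus)
  finally show ?thesis .
qed

text \<open>Young's inequality for L1, by Tonelli's theorem. \<open>G\<close> extends g by 0, so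
  that the inner integral runs over the whole line.\<close>

lemma L1_norm_convolution_le:
  fixes K g :: "real \<Rightarrow> complex"
  assumes K: "continuous_on UNIV K" and g: "set_integrable lborel {0..2 * pi} g"
    and bd: "\<And>y. 0 \<le> y \<Longrightarrow> y \<le> 2 * pi \<Longrightarrow>
      (\<integral>\<^sup>+x\<in>{0..2 * pi}. ennreal (norm (K (x - y))) \<partial>lborel) \<le> B"
  shows "L1_norm (\<lambda>x. LINT y:{0..2 * pi}|lborel. g y * K (x - y)) \<le> B * L1_norm g"
proof -
  define G where "G = (\<lambda>y. indicator {0..2 * pi} y *\<^sub>R g y)"
  have [measurable]: "G \<in> borel_measurable borel"
    using g unfolding set_integrable_def G_def by (auto dest: borel_measurable_integrable)
  have [measurable]: "K \<in> borel_measurable borel"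
    using K by (rule borel_measurable_continuous_onI)
  have L: "L1_norm g = (\<integral>\<^sup>+y. ennreal (norm (G y)) \<partial>lborel)"
    unfolding L1_norm_def G_def by (intro nn_integral_cong) (simp add: indicator_def)
  have pt: "ennreal (norm (LINT y:{0..2 * pi}|lborel. g y * K (x - y)))
    \<le> (\<integral>\<^sup>+y. ennreal (norm (G y)) * ennreal (norm (K (x - y))) \<partial>lborel)" for x
  proof -
    have "(LINT y:{0..2 * pi}|lborel. g y * K (x - y)) = (LINT y|lborel. G y * K (x - y))"
      unfolding set_lebesgue_integral_def G_def by simp
    \<comment> \<open>If the product is not integrable, its integral is 0 by convention and the
      bound is trivial.\<close>
    also have "ennreal (norm \<dots>) \<le> (\<integral>\<^sup>+y. ennreal (norm (G y * K (x - y))) \<partial>lborel)"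
      by (cases "integrable lborel (\<lambda>y. G y * K (x - y))")
        (auto intro: integral_norm_bound_ennreal simp: not_integrable_integral_eq)
    finally show ?thesis by (simp add: norm_mult ennreal_mult)
  qed
  have "L1_norm (\<lambda>x. LINT y:{0..2 * pi}|lborel. g y * K (x - y))
    \<le> (\<integral>\<^sup>+x. (\<integral>\<^sup>+y. ennreal (norm (G y)) * ennreal (norm (K (x - y))) * indicator {0..2 * pi} x \<partial>lborel) \<partial>lborel)"
    unfolding L1_norm_def
    by (intro nn_integral_mono) (auto simp: indicator_def pt)
  also have "\<dots> = (\<integral>\<^sup>+y. (\<integral>\<^sup>+x. ennreal (norm (G y)) * ennreal (norm (K (x - y))) * indicator {0..2 * pi} x \<partial>lborel) \<partial>lborel)"
    by (rule lborel_pair.Fubini') measurable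
  also have "\<dots> \<le> (\<integral>\<^sup>+y. B * ennreal (norm (G y)) \<partial>lborel)"
  proof (intro nn_integral_mono)
    fix y :: real
    have "(\<integral>\<^sup>+x. ennreal (norm (G y)) * ennreal (norm (K (x - y))) * indicator {0..2 * pi} x \<partial>lborel)
      = ennreal (norm (G y)) * (\<integral>\<^sup>+x\<in>{0..2 * pi}. ennreal (norm (K (x - y))) \<partial>lborel)"
      by (simp add: nn_integral_cmult mult.assoc)
    also have "\<dots> \<le> ennreal (norm (G y)) * B"
    proof (cases "0 \<le> y \<and> y \<le> 2 * pi")
      case True
      then show ?thesis by (intro mult_left_mono bd) auto
    next
      case False
      then show ?thesis by (auto simp: G_def indicator_def)
    qed
    finally show "(\<integral>\<^sup>+x. ennreal (norm (G y)) * ennreal (norm (K (x - y))) * indicator {0..2 * pi} x \<partial>lborel)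
      \<le> B * ennreal (norm (G y))" by (simp add: mult.commute)
  qed
  also have "\<dots> = B * L1_norm g"
    unfolding L by (rule nn_integral_cmult) simp
  finally show ?thesis .
qed

section \<open>Derivatives of the means\<close>

lemma vp_cutoff_eq_0: "vp_cutoff \<eta> \<Longrightarrow> x \<ge> 1 \<Longrightarrow> \<eta> x = 0"
  by (simp add: vp_cutoff_def)

lemma vp_cutoff_coeff_eq_0:
  assumes "vp_cutoff \<eta>" "N \<ge> 1" "\<bar>k\<bar> \<ge> int N"
  shows "\<eta> (of_int \<bar>k\<bar> / of_nat N) = 0"
proof -
  have "real_of_int \<bar>k\<bar> \<ge> real N" using assms(3) by linarith
  then show ?thesis using assms by (intro vp_cutoff_eq_0) auto
qed

text \<open>The window keeps the two end terms although they vanish: summation by parts wants zero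
  coefficients there.\<close>

lemma vp_mean_eq_sum:
  assumes "vp_cutoff \<eta>" "N \<ge> 1"
  shows "vp_mean \<eta> N f x = (\<Sum>k\<in>{-int N..int N}.
    of_real (\<eta> (of_int \<bar>k\<bar> / of_nat N)) * fourier_coeff f k * exp (\<i> * of_int k * of_real x))"
proof -
  have "\<eta> (of_int \<bar>k\<bar> / of_nat N) = 0" if "k \<notin> {-int N..int N}" for k
    by (rule vp_cutoff_coeff_eq_0[OF assms]) (use that in auto)
  then have "vp_mean \<eta> N f x = (\<Sum>\<^sub>\<infinity>k\<in>{-int N..int N}.
    of_real (\<eta> (of_int \<bar>k\<bar> / of_nat N)) * fourier_coeff f k * exp (\<i> * of_int k * of_real x))"
    unfolding vp_mean_def
    by (intro infsum_cong_neutral) (auto simp del: of_int_abs)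
  then show ?thesis by simp
qed

lemma nth_derivative_trig_sum:
  assumes "finite S"
  shows "nth_derivative m (\<lambda>x. \<Sum>k\<in>S. b k * exp (\<i> * of_int k * of_real x))
    = (\<lambda>x. \<Sum>k\<in>S. b k * (\<i> * of_int k) ^ m * exp (\<i> * of_int k * of_real x))"
proof (induction m)
  case 0
  then show ?case by (simp add: nth_derivative_def)
next
  case (Suc m)
  have "vector_derivative (\<lambda>x. \<Sum>k\<in>S. b k * (\<i> * of_int k) ^ m * exp (\<i> * of_int k * of_real x)) (at x)
    = (\<Sum>k\<in>S. b k * (\<i> * of_int k) ^ Suc m * exp (\<i> * of_int k * of_real x))" for x
  proof (rule vector_derivative_at, rule has_vector_derivative_sum)
    fix k :: int
    have "((\<lambda>z. b k * (\<i> * of_int k) ^ m * exp (\<i> * of_int k * z)) has_field_derivative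
      b k * (\<i> * of_int k) ^ Suc m * exp (\<i> * of_int k * of_real x)) (at (of_real x))"
      by (auto intro!: derivative_eq_intros simp: algebra_simps)
    then show "((\<lambda>x. b k * (\<i> * of_int k) ^ m * exp (\<i> * of_int k * complex_of_real x)) has_vector_derivative
      b k * (\<i> * of_int k) ^ Suc m * exp (\<i> * of_int k * complex_of_real x)) (at x)"
      by (rule has_vector_derivative_real_field)
  qed
  then show ?case using Suc by (simp add: nth_derivative_def)
qed

lemma nth_derivative_vp_mean:
  assumes "vp_cutoff \<eta>" "N \<ge> 1"
  shows "nth_derivative m (vp_mean \<eta> N f) x = (\<Sum>k\<in>{-int N..int N}.
    of_real (\<eta> (of_int \<bar>k\<bar> / of_nat N)) * fourier_coeff f k * (\<i> * of_int k) ^ m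
      * exp (\<i> * of_int k * of_real x))"
  unfolding vp_mean_eq_sum[OF assms, abs_def]
  by (subst nth_derivative_trig_sum) auto

lemma set_integrable_fourier:
  assumes "set_integrable lborel {0..2 * pi} f"
  shows "set_integrable lborel {0..2 * pi} (\<lambda>y. f y * exp (- (\<i> * of_int k * of_real y)))"
proof -
  have "integrable lborel (\<lambda>y. exp (- (\<i> * of_int k * complex_of_real y)) * (indicator {0..2*pi} y *\<^sub>R f y))"
  proof (rule Bochner_Integration.integrable_bound)
    show "integrable lborel (\<lambda>y. indicator {0..2*pi} y *\<^sub>R f y)"
      using assms unfolding set_integrable_def .
    from borel_measurable_integrable[OF this] show "(\<lambda>y. exp (- (\<i> * of_int k * complex_of_real y)) * (indicator {0..2*pi} y *\<^sub>R f y))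
        \<in> borel_measurable lborel"
      by (intro borel_measurable_times) (auto intro!: borel_measurable_continuous_onI continuous_intros)
  qed (auto simp: norm_mult norm_exp_eq_Re)
  then show ?thesis
    unfolding set_integrable_def by (simp add: mult.commute)
qed

lemma trig_sum_fourier_eq_convolution:
  assumes f: "set_integrable lborel {0..2 * pi} f" and S: "finite S"
  shows "(\<Sum>k\<in>S. c k * fourier_coeff f k * exp (\<i> * of_int k * of_real x))
    = (LINT y:{0..2 * pi}|lborel. f y *
        (1 / (2 * pi) * (\<Sum>k\<in>S. c k * exp (\<i> * of_int k * of_real (x - y)))))"
proof -
  have "(\<Sum>k\<in>S. c k * fourier_coeff f k * exp (\<i> * of_int k * of_real x))
    = (\<Sum>k\<in>S. LINT y:{0..2 * pi}|lborel. (1 / (2 * pi) * c k * exp (\<i> * of_int k * of_real x))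
          * (f y * exp (- (\<i> * of_int k * of_real y))))"
    unfolding fourier_coeff_def by (subst set_integral_mult_right) (simp add: mult_ac)
  also have "\<dots> = (LINT y:{0..2 * pi}|lborel. (\<Sum>k\<in>S. (1 / (2 * pi) * c k * exp (\<i> * of_int k * of_real x))
          * (f y * exp (- (\<i> * of_int k * of_real y)))))"
    unfolding set_lebesgue_integral_def scaleR_sum_right
    by (subst Bochner_Integration.integral_sum)
      (rule set_integrable_mult_right[OF set_integrable_fourier[OF f], unfolded set_integrable_def], rule refl)
  also have "\<dots> = (LINT y:{0..2 * pi}|lborel. f y *
        (1 / (2 * pi) * (\<Sum>k\<in>S. c k * exp (\<i> * of_int k * of_real (x - y)))))"
  proof -
    have "exp (\<i> * of_int k * of_real (x - y)) =
      exp (\<i> * of_int k * of_real x) * exp (- (\<i> * of_int k * of_real y))" for k y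
      by (simp add: exp_add[symmetric] algebra_simps)
    then show ?thesis
      by (simp only: sum_distrib_left mult_ac)
  qed
  finally show ?thesis .
qed

text \<open>The kernel of $(\eta_N f)^{(m)}$ is
  $(iN)^m$ times the trigonometric sum with coefficients \<open>(k/N)^m \<eta>(|k|/N)\<close>.\<close>

lemma vp_mean_bernstein:
  assumes \<eta>: "vp_cutoff \<eta>"
  obtains C where "C \<ge> 0"
    and "\<And>N (f :: real \<Rightarrow> complex). N \<ge> 2 \<Longrightarrow> set_integrable lborel {0..2 * pi} f \<Longrightarrow>
      L1_norm (nth_derivative m (vp_mean \<eta> N f)) \<le> ennreal (C * real N ^ m) * L1_norm f"
proof -
  obtain A where A:
    "\<And>(N::nat) (k::int). N \<ge> 2 \<Longrightarrow> \<bar>(of_int k / real N) ^ m * \<eta> (of_int \<bar>k\<bar> / real N)\<bar> \<le> A"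
    "\<And>(N::nat) (k::int). N \<ge> 2 \<Longrightarrow>
       \<bar>(of_int (k + 1) / real N) ^ m * \<eta> (of_int \<bar>k + 1\<bar> / real N)
        - 2 * ((of_int k / real N) ^ m * \<eta> (of_int \<bar>k\<bar> / real N))
        + (of_int (k - 1) / real N) ^ m * \<eta> (of_int \<bar>k - 1\<bar> / real N)\<bar> \<le> A / (real N)\<^sup>2"
    using vp_multiplier_bounds[OF \<eta>, of m] by blast
  have A0: "A \<ge> 0" using A(1)[of 2 0] abs_ge_zero order_trans by (metis order_refl)
  show ?thesis
  \<comment> \<open>The factor 15 comes from the pointwise bound of the kernel, 3 pi from
    integrating it over a period.\<close>
  proof (rule that[of "45 * A * pi"])
    show "45 * A * pi \<ge> 0" using A0 by simp
    fix N :: nat and f :: "real \<Rightarrow> complex" assume N: "N \<ge> 2" and f: "set_integrable lborel {0..2 * pi} f"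
    define c where "c = (\<lambda>k::int. (of_int k / real N) ^ m * \<eta> (of_int \<bar>k\<bar> / real N))"
    define d where "d = (\<lambda>k::int. (\<i> * of_nat N) ^ m * complex_of_real (c k))"
    define K where "K = (\<lambda>t. 1 / (2 * pi) * (\<Sum>k\<in>{-int N..int N}. d k * exp (\<i> * of_int k * complex_of_real t)))"
    have d_eq: "of_real (\<eta> (of_int \<bar>k\<bar> / of_nat N)) * (\<i> * of_int k) ^ m = d k" for k
      using N by (simp add: d_def c_def power_mult_distrib power_divide)
    have conv: "nth_derivative m (vp_mean \<eta> N f) = (\<lambda>x. LINT y:{0..2 * pi}|lborel. f y * K (x - y))"
      using nth_derivative_vp_mean[OF \<eta>, of N m f] trig_sum_fourier_eq_convolution[OF f, of "{-int N..int N}" d] N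
      by (auto simp: K_def fun_eq_iff d_eq[symmetric] mult_ac)
    have nd: "norm (d k) = real N ^ m * \<bar>c k\<bar>" for k
      by (simp add: d_def norm_mult norm_power)
    have nd2: "norm (d (k + 1) - 2 * d k + d (k - 1)) = real N ^ m * \<bar>c (k + 1) - 2 * c k + c (k - 1)\<bar>" for k
    proof -
      have "d (k + 1) - 2 * d k + d (k - 1)
        = (\<i> * of_nat N) ^ m * complex_of_real (c (k + 1) - 2 * c k + c (k - 1))"
        by (simp add: d_def algebra_simps)
      then show ?thesis by (simp only: norm_mult norm_power norm_of_real) simp
    qed
    have Kbd: "norm (K t) \<le> 15 * (real N ^ m * A) * (real N / (1 + (real N * t)\<^sup>2))" if t: "\<bar>t\<bar> \<le> pi" for t
    proof -
      have "norm (\<Sum>k\<in>{-int N..int N}. d k * exp (\<i> * of_int k * complex_of_real t))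
        \<le> 15 * (real N ^ m * A) * (real N / (1 + (real N * t)\<^sup>2))"
      proof (rule trig_sum_kernel_bound)
        show "d k = 0" if "\<bar>k\<bar> \<ge> int N" for k
          using vp_cutoff_coeff_eq_0[OF \<eta> _ that] N by (simp add: d_def c_def)
        show "norm (d k) \<le> real N ^ m * A" for k
          unfolding nd c_def by (intro mult_left_mono A N) auto
        show "norm (d (k + 1) - 2 * d k + d (k - 1)) \<le> real N ^ m * A / (real N)\<^sup>2" for k
          unfolding nd2 c_def times_divide_eq_right[symmetric] by (intro mult_left_mono A N) auto
      qed (use N t in auto)
      moreover have "norm (K t) \<le> norm (\<Sum>k\<in>{-int N..int N}. d k * exp (\<i> * of_int k * complex_of_real t))"
      proof -
        have "norm (1 / (2 * complex_of_real pi)) \<le> 1"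
          using pi_ge_two by (simp add: norm_divide norm_mult)
        then show ?thesis
          unfolding K_def norm_mult by (intro mult_left_le_one_le) auto
      qed
      ultimately show ?thesis by linarith
    qed
    have per: "K (t + 2 * pi) = K t" for t
    proof -
      have "exp (\<i> * of_int k * complex_of_real (t + 2 * pi)) = exp (\<i> * of_int k * complex_of_real t)" for k
        using exp_plus_2pin[of "\<i> * of_int k * complex_of_real t" k]
        by (simp add: algebra_simps)
      then show ?thesis by (simp only: K_def)
    qed
    have "L1_norm (nth_derivative m (vp_mean \<eta> N f)) \<le> ennreal (3 * pi * (15 * (real N ^ m * A))) * L1_norm f"
      unfolding conv
    proof (rule L1_norm_convolution_le[OF _ f])
      show "continuous_on UNIV K"
        unfolding K_def by (intro continuous_intros)
      show "(\<integral>\<^sup>+x\<in>{0..2 * pi}. ennreal (norm (K (x - y))) \<partial>lborel)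
        \<le> ennreal (3 * pi * (15 * (real N ^ m * A)))" if "0 \<le> y" "y \<le> 2 * pi" for y
        by (rule nn_integral_periodic_kernel_le[where N = "real N"])
          (use N A0 that per Kbd in auto)
    qed
    then show "L1_norm (nth_derivative m (vp_mean \<eta> N f)) \<le> ennreal (45 * A * pi * real N ^ m) * L1_norm f"
      by (simp add: mult_ac)
  qed
qed

text \<open>Integration by parts. Only the values at 0 and 2 pi have to agree, so this applies to
  dilated bumps on the line without periodising them.\<close>

lemma fourier_coeff_deriv:
  fixes F f :: "real \<Rightarrow> complex"
  assumes F: "\<And>x. (F has_vector_derivative f x) (at x)" and f: "continuous_on UNIV f"
    and per: "F 0 = F (2 * pi)"
  shows "fourier_coeff f k = \<i> * of_int k * fourier_coeff F k"
proof -
  let ?e = "\<lambda>y::real. exp (- (\<i> * of_int k * of_real y))"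
  let ?h = "\<lambda>y. f y * ?e y - \<i> * of_int k * (F y * ?e y)"
  have cF: "continuous_on UNIV F"
    using F by (meson continuous_at_imp_continuous_on has_vector_derivative_continuous)
  have e: "(?e has_vector_derivative - (\<i> * of_int k) * ?e y) (at y)" for y
    by (rule has_vector_derivative_real_field) (auto intro!: derivative_eq_intros)
  have "((\<lambda>y. F y * ?e y) has_vector_derivative ?h y) (at y within {0..2 * pi})" for y
    by (rule has_vector_derivative_at_within)
      (use has_vector_derivative_mult[OF F[of y] e[of y]] in \<open>simp add: algebra_simps\<close>)
  then have "(LINT y:{0..2 * pi}|lborel. ?h y) = F (2 * pi) * ?e (2 * pi) - F 0 * ?e 0"
    unfolding set_lebesgue_integral_def
    by (intro integral_FTC_atLeastAtMost)
      (auto intro!: continuous_intros continuous_on_subset[OF f] continuous_on_subset[OF cF])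
  also have "\<dots> = 0"
    using per exp_plus_2pin[of 0 "- k"] by (simp add: algebra_simps)
  finally have "0 = (LINT y:{0..2 * pi}|lborel. ?h y)" by simp
  also have "\<dots> = (LINT y:{0..2 * pi}|lborel. f y * ?e y) - \<i> * of_int k * (LINT y:{0..2 * pi}|lborel. F y * ?e y)"
    by (subst set_integral_diff)
      (auto intro!: borel_integrable_atLeastAtMost' continuous_intros
        continuous_on_subset[OF f] continuous_on_subset[OF cF])
  finally show ?thesis by (simp add: fourier_coeff_def)
qed

text \<open>The mean acts by multipliers, so it commutes with differentiation. A derivative can thus
  be moved between the function and the mean, which trades powers of N against the scale of the
  function.\<close>

lemma nth_derivative_vp_mean_deriv:
  fixes F f :: "real \<Rightarrow> complex"
  assumes "vp_cutoff \<eta>" "N \<ge> 1"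
    and F: "\<And>x. (F has_vector_derivative f x) (at x)" and f: "continuous_on UNIV f"
    and per: "F 0 = F (2 * pi)"
  shows "nth_derivative m (vp_mean \<eta> N f) = nth_derivative (Suc m) (vp_mean \<eta> N F)"
  by (rule ext) (simp add: nth_derivative_vp_mean[OF assms(1,2)] fourier_coeff_deriv[OF F f per] mult_ac)

section \<open>Series of functions\<close>

lemma L1_norm_eq_set_integral:
  assumes "set_integrable lborel {0..2 * pi} f"
  shows "L1_norm f = ennreal (LINT x:{0..2 * pi}|lborel. norm (f x))"
proof -
  have "L1_norm f = (\<integral>\<^sup>+x. ennreal (norm (indicator {0..2 * pi} x *\<^sub>R f x)) \<partial>lborel)"
    unfolding L1_norm_def by (intro nn_integral_cong) (simp add: indicator_def)
  also have "\<dots> = ennreal (LINT x|lborel. norm (indicator {0..2 * pi} x *\<^sub>R f x))"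
    using assms unfolding set_integrable_def by (intro nn_integral_eq_integral integrable_norm) auto
  also have "\<dots> = ennreal (LINT x:{0..2 * pi}|lborel. norm (f x))"
    unfolding set_lebesgue_integral_def by simp
  finally show ?thesis .
qed

lemma summable_set_integral_norm:
  fixes u :: "nat \<Rightarrow> real \<Rightarrow> complex"
  assumes "\<And>j. set_integrable lborel {0..2 * pi} (u j)" and "(\<Sum>j. L1_norm (u j)) < \<infinity>"
  shows "summable (\<lambda>j. LINT x:{0..2 * pi}|lborel. norm (u j x))"
proof (rule summable_suminf_not_top)
  show "0 \<le> (LINT x:{0..2 * pi}|lborel. norm (u j x))" for j
    unfolding set_lebesgue_integral_def by (intro Bochner_Integration.integral_nonneg) auto
  show "(\<Sum>j. ennreal (LINT x:{0..2 * pi}|lborel. norm (u j x))) \<noteq> top"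
    using assms(2) unfolding L1_norm_eq_set_integral[OF assms(1)] by simp
qed

lemma norm_fourier_coeff_le:
  assumes "set_integrable lborel {0..2 * pi} g"
  shows "norm (fourier_coeff g k) \<le> (LINT x:{0..2 * pi}|lborel. norm (g x))"
proof -
  have "norm (fourier_coeff g k) \<le> norm (LINT y:{0..2 * pi}|lborel. g y * exp (- (\<i> * of_int k * of_real y)))"
  proof -
    have "norm (1 / (2 * complex_of_real pi)) \<le> 1"
      using pi_ge_two by (simp add: norm_divide norm_mult)
    then show ?thesis
      unfolding fourier_coeff_def norm_mult by (intro mult_left_le_one_le) auto
  qed
  also have "\<dots> \<le> (LINT y:{0..2 * pi}|lborel. norm (g y * exp (- (\<i> * of_int k * of_real y))))"
    by (rule set_integral_norm_bound[OF set_integrable_fourier[OF assms]])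
  also have "\<dots> = (LINT x:{0..2 * pi}|lborel. norm (g x))"
    by (simp add: norm_mult norm_exp_eq_Re)
  finally show ?thesis .
qed

context
  fixes u :: "nat \<Rightarrow> real \<Rightarrow> complex" and f :: "real \<Rightarrow> complex"
  assumes u: "\<And>j. set_integrable lborel {0..2 * pi} (u j)"
    and fin: "(\<Sum>j. L1_norm (u j)) < \<infinity>"
    and pt: "\<And>x. 0 \<le> x \<Longrightarrow> x \<le> 2 * pi \<Longrightarrow> summable (\<lambda>j. norm (u j x))"
    and f: "\<And>x. 0 \<le> x \<Longrightarrow> x \<le> 2 * pi \<Longrightarrow> f x = (\<Sum>j. u j x)"
begin

lemma set_integrable_suminf: "set_integrable lborel {0..2 * pi} f"
proof -
  have "integrable lborel (\<lambda>x. \<Sum>j. indicator {0..2 * pi} x *\<^sub>R u j x)"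
    by (rule integrable_suminf)
      (use u summable_set_integral_norm[OF u fin] pt in
        \<open>auto simp: set_integrable_def set_lebesgue_integral_def indicator_def\<close>)
  also have "(\<lambda>x. \<Sum>j. indicator {0..2 * pi} x *\<^sub>R u j x) = (\<lambda>x. indicator {0..2 * pi} x *\<^sub>R f x)"
    by (auto simp: fun_eq_iff indicator_def f)
  finally show ?thesis unfolding set_integrable_def .
qed

lemma summable_norm_fourier_coeff: "summable (\<lambda>j. norm (fourier_coeff (u j) k))"
  by (rule summable_comparison_test'[OF summable_set_integral_norm[OF u fin], of 0])
    (simp add: norm_fourier_coeff_le[OF u])

lemma fourier_coeff_suminf: "fourier_coeff f k = (\<Sum>j. fourier_coeff (u j) k)"
proof -
  let ?e = "\<lambda>y. exp (- (\<i> * of_int k * complex_of_real y))"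
  let ?v = "\<lambda>j y. indicator {0..2 * pi} y *\<^sub>R (u j y * ?e y)"
  have ne: "norm (?v j y) = indicator {0..2 * pi} y *\<^sub>R norm (u j y)" for j y
    by (simp add: norm_mult norm_exp_eq_Re)
  have v: "integrable lborel (?v j)" for j
    using set_integrable_fourier[OF u] unfolding set_integrable_def .
  have sp: "AE y in lborel. summable (\<lambda>j. norm (?v j y))"
    unfolding ne using pt by (auto simp: indicator_def)
  have si: "summable (\<lambda>j. LINT y|lborel. norm (?v j y))"
    using summable_set_integral_norm[OF u fin] unfolding ne set_lebesgue_integral_def .
  have "(LINT y:{0..2 * pi}|lborel. f y * ?e y) = (LINT y|lborel. (\<Sum>j. ?v j y))"
    unfolding set_lebesgue_integral_def
  proof (intro Bochner_Integration.integral_cong refl)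
    fix y
    show "indicator {0..2 * pi} y *\<^sub>R (f y * ?e y) = (\<Sum>j. ?v j y)"
      using suminf_mult2[OF summable_norm_cancel[OF pt[of y]], of "?e y"]
      by (auto simp: indicator_def f)
  qed
  also have "\<dots> = (\<Sum>j. LINT y|lborel. ?v j y)"
    by (rule integral_suminf[OF v sp si])
  finally have "fourier_coeff f k = 1 / (2 * pi) * (\<Sum>j. LINT y|lborel. ?v j y)"
    unfolding fourier_coeff_def by simp
  also have "\<dots> = (\<Sum>j. 1 / (2 * pi) * (LINT y|lborel. ?v j y))"
    using summable_integral[OF v sp si] by (rule suminf_mult[symmetric])
  finally show ?thesis
    unfolding fourier_coeff_def set_lebesgue_integral_def .
qed

text \<open>For fixed N and x the derivative of the mean is a finite combination of Fourier
  coefficients, and these pass through the series. So the triangle inequality for infinite sums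
  holds pointwise, and it is integrated term by term.\<close>

lemma L1_norm_vp_mean_suminf_le:
  assumes \<eta>: "vp_cutoff \<eta>" and N: "N \<ge> 1"
  shows "L1_norm (nth_derivative m (vp_mean \<eta> N f)) \<le> (\<Sum>j. L1_norm (nth_derivative m (vp_mean \<eta> N (u j))))"
proof -
  define b where "b = (\<lambda>(k::int) (x::real). of_real (\<eta> (of_int \<bar>k\<bar> / of_nat N)) * (\<i> * of_int k) ^ m
      * exp (\<i> * of_int k * complex_of_real x))"
  have D: "nth_derivative m (vp_mean \<eta> N g) x = (\<Sum>k\<in>{-int N..int N}. b k x * fourier_coeff g k)" for g x
    unfolding nth_derivative_vp_mean[OF \<eta> N] b_def by (simp add: mult_ac)
  have meas: "(\<lambda>x. nth_derivative m (vp_mean \<eta> N g) x) \<in> borel_measurable borel" for g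
    unfolding D b_def by (intro borel_measurable_continuous_onI continuous_intros)
  have snorm: "summable (\<lambda>j. norm (b k x * fourier_coeff (u j) k))" for k x
    unfolding norm_mult by (intro summable_mult summable_norm_fourier_coeff)
  have Ds: "summable (\<lambda>j. norm (nth_derivative m (vp_mean \<eta> N (u j)) x))" for x
    unfolding D
    by (rule summable_comparison_test'[OF summable_sum[where I = "{-int N..int N}", OF snorm], of 0])
      (auto intro: norm_sum)
  have "nth_derivative m (vp_mean \<eta> N f) x = (\<Sum>j. nth_derivative m (vp_mean \<eta> N (u j)) x)" for x
  proof -
    have "nth_derivative m (vp_mean \<eta> N f) x = (\<Sum>k\<in>{-int N..int N}. \<Sum>j. b k x * fourier_coeff (u j) k)"
      unfolding D fourier_coeff_suminf
      by (subst suminf_mult) (auto intro: summable_norm_cancel summable_norm_fourier_coeff)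
    also have "\<dots> = (\<Sum>j. nth_derivative m (vp_mean \<eta> N (u j)) x)"
      unfolding D by (rule suminf_sum[symmetric]) (rule summable_norm_cancel[OF snorm])
    finally show ?thesis .
  qed
  then have le: "ennreal (norm (nth_derivative m (vp_mean \<eta> N f) x))
      \<le> (\<Sum>j. ennreal (norm (nth_derivative m (vp_mean \<eta> N (u j)) x)))" for x
    using summable_norm[OF Ds] ennreal_leI[OF summable_norm[OF Ds, of x]]
    by (subst suminf_ennreal) (auto simp: ennreal_suminf_neq_top Ds)
  have "L1_norm (nth_derivative m (vp_mean \<eta> N f))
    \<le> (\<integral>\<^sup>+x\<in>{0..2*pi}. (\<Sum>j. ennreal (norm (nth_derivative m (vp_mean \<eta> N (u j)) x))) \<partial>lborel)"
    unfolding L1_norm_def by (intro nn_integral_mono mult_right_mono le) (rule zero_le)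
  also have "\<dots> = (\<integral>\<^sup>+x. (\<Sum>j. ennreal (norm (nth_derivative m (vp_mean \<eta> N (u j)) x)) * indicator {0..2*pi} x) \<partial>lborel)"
    by (simp only: ennreal_suminf_multc)
  also have "\<dots> = (\<Sum>j. L1_norm (nth_derivative m (vp_mean \<eta> N (u j))))"
    unfolding L1_norm_def
  proof (rule nn_integral_suminf)
    fix j
    note [measurable] = meas[of "u j"]
    show "(\<lambda>x. ennreal (norm (nth_derivative m (vp_mean \<eta> N (u j)) x)) * indicator {0..2*pi} x) \<in> borel_measurable lborel"
      by measurable
  qed
  finally show ?thesis .
qed

end

section \<open>The lacunary example\<close>

text \<open>The error of the linear approximation is at most h^2 whatever the signs of x and x + h,
  so the bump built from this truncation needs no gluing of derivatives.\<close>

lemma has_real_derivative_max_0_square: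
  "((\<lambda>y::real. (max 0 y)\<^sup>2) has_real_derivative 2 * max 0 x) (at x)"
proof -
  have bd: "\<bar>((max 0 (x + h))\<^sup>2 - (max 0 x)\<^sup>2) / h - 2 * max 0 x\<bar> \<le> \<bar>h\<bar>" if "h \<noteq> 0" for h
  proof -
    have "\<bar>(max 0 (x + h))\<^sup>2 - (max 0 x)\<^sup>2 - 2 * max 0 x * h\<bar> \<le> h\<^sup>2"
    proof -
      consider "x \<ge> 0" "x + h \<ge> 0" | "x \<ge> 0" "x + h < 0" | "x < 0" "x + h < 0" | "x < 0" "x + h \<ge> 0"
        by linarith
      then show ?thesis
      proof cases
        case 1
        then show ?thesis by (simp add: power2_eq_square algebra_simps)
      next
        case 2
        then have m: "max 0 (x + h) = 0" "max 0 x = x" by auto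
        have "0 \<le> x * (- x - 2 * h)" "0 \<le> (x + h)\<^sup>2" using 2 by auto
        then show ?thesis unfolding m by (simp add: power2_eq_square algebra_simps abs_le_iff)
      next
        case 3
        then show ?thesis by simp
      next
        case 4
        then have m: "max 0 (x + h) = x + h" "max 0 x = 0" by auto
        have "(x + h)\<^sup>2 \<le> h\<^sup>2" using 4 by (intro power_mono) auto
        then show ?thesis unfolding m by simp
      qed
    qed
    moreover have "((max 0 (x + h))\<^sup>2 - (max 0 x)\<^sup>2) / h - 2 * max 0 x
      = ((max 0 (x + h))\<^sup>2 - (max 0 x)\<^sup>2 - 2 * max 0 x * h) / h"
      using that by (simp add: field_simps)
    moreover have "h\<^sup>2 = \<bar>h\<bar> * \<bar>h\<bar>" by (simp add: power2_eq_square)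
    moreover have "\<bar>h\<bar> > 0" using that by simp
    ultimately show ?thesis by (simp only: abs_divide pos_divide_le_eq)
  qed
  have "((\<lambda>h. ((max 0 (x + h))\<^sup>2 - (max 0 x)\<^sup>2) / h - 2 * max 0 x) \<longlongrightarrow> 0) (at 0)"
  proof (rule Lim_null_comparison[where g = "\<lambda>h. \<bar>h\<bar>"])
    show "\<forall>\<^sub>F h in at 0. norm (((max 0 (x + h))\<^sup>2 - (max 0 x)\<^sup>2) / h - 2 * max 0 x) \<le> \<bar>h\<bar>"
      unfolding eventually_at_filter real_norm_def using bd by (intro always_eventually) blast
  qed (rule tendsto_rabs_zero[OF tendsto_ident_at])
  then have "((\<lambda>h. ((max 0 (x + h))\<^sup>2 - (max 0 x)\<^sup>2) / h) \<longlongrightarrow> 2 * max 0 x) (at 0)"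
    by (rule LIM_zero_cancel)
  then show ?thesis by (simp add: DERIV_def)
qed

text \<open>The cube is the least integer power of the positive part that is twice continuously
  differentiable: \<open>bump\<close> serves as antiderivative of the wavelet and
  \<open>bump_deriv2\<close> as its derivative. The maximum 1/64 is attained at 3/2.\<close>

definition bump :: "real \<Rightarrow> real" where
  "bump x = (max 0 ((x - 1) * (2 - x))) ^ 3"

definition bump_deriv :: "real \<Rightarrow> real" where
  "bump_deriv x = 3 * (max 0 ((x - 1) * (2 - x)))\<^sup>2 * (3 - 2 * x)"

definition bump_deriv2 :: "real \<Rightarrow> real" where
  "bump_deriv2 x = 6 * max 0 ((x - 1) * (2 - x)) * (3 - 2 * x)\<^sup>2 - 6 * (max 0 ((x - 1) * (2 - x)))\<^sup>2"

lemma has_real_derivative_bump_square: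
  "((\<lambda>x. (max 0 ((x - 1) * (2 - x)))\<^sup>2) has_real_derivative
     2 * max 0 ((x - 1) * (2 - x)) * (3 - 2 * x)) (at x)"
  by (rule DERIV_chain2[OF has_real_derivative_max_0_square])
    (auto intro!: derivative_eq_intros)

lemma has_real_derivative_bump: "(bump has_real_derivative bump_deriv x) (at x)"
proof -
  \<comment> \<open>Next to a square of \<open>max 0 u\<close>, a further factor
    \<open>max 0 u\<close> may be replaced by u; this reduces the cube to the derivative already
    known.\<close>
  have "max 0 u ^ 3 = (max 0 u)\<^sup>2 * u" for u :: real
    by (simp add: max_def power2_eq_square power3_eq_cube)
  then have "bump = (\<lambda>x. (max 0 ((x - 1) * (2 - x)))\<^sup>2 * ((x - 1) * (2 - x)))"
    by (simp add: bump_def fun_eq_iff)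
  moreover have "((\<lambda>x. (max 0 ((x - 1) * (2 - x)))\<^sup>2 * ((x - 1) * (2 - x))) has_real_derivative
      2 * max 0 ((x - 1) * (2 - x)) * (3 - 2 * x) * ((x - 1) * (2 - x))
      + (3 - 2 * x) * (max 0 ((x - 1) * (2 - x)))\<^sup>2) (at x)"
    by (rule DERIV_mult[OF has_real_derivative_bump_square]) (auto intro!: derivative_eq_intros)
  moreover have "2 * max 0 ((x - 1) * (2 - x)) * (3 - 2 * x) * ((x - 1) * (2 - x))
      + (3 - 2 * x) * (max 0 ((x - 1) * (2 - x)))\<^sup>2 = bump_deriv x"
  proof -
    have "2 * max 0 u * v * u + v * (max 0 u)\<^sup>2 = 3 * (max 0 u)\<^sup>2 * v" for u v :: real
      by (simp add: max_def power2_eq_square)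
    then show ?thesis unfolding bump_deriv_def .
  qed
  ultimately show ?thesis by simp
qed

lemma has_real_derivative_bump_deriv: "(bump_deriv has_real_derivative bump_deriv2 x) (at x)"
proof -
  have "((\<lambda>x. 3 * (max 0 ((x - 1) * (2 - x)))\<^sup>2 * (3 - 2 * x)) has_real_derivative
      3 * (2 * max 0 ((x - 1) * (2 - x)) * (3 - 2 * x)) * (3 - 2 * x)
      + (- 2) * (3 * (max 0 ((x - 1) * (2 - x)))\<^sup>2)) (at x)"
    by (rule DERIV_mult[OF DERIV_cmult[OF has_real_derivative_bump_square]])
      (auto intro!: derivative_eq_intros)
  then show ?thesis
    unfolding bump_deriv_def[abs_def] bump_deriv2_def
    by (rule DERIV_cong) (simp add: power2_eq_square mult_ac)
qed

lemma bump_eq_0: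
  assumes "x \<le> 1 \<or> x \<ge> 2"
  shows "bump x = 0" "bump_deriv x = 0" "bump_deriv2 x = 0"
proof -
  have "(x - 1) * (2 - x) \<le> 0"
    using assms by (auto simp: mult_le_0_iff)
  then show "bump x = 0" "bump_deriv x = 0" "bump_deriv2 x = 0"
    by (simp_all add: bump_def bump_deriv_def bump_deriv2_def max_def)
qed

text \<open>On (1, 2) the numbers \<open>p\<close> and \<open>r\<close> of the proof are at most 1
  in absolute value. The constant 12 = 6 + 6 comes from the two terms of the second derivative and
  serves for all three functions.\<close>

lemma bump_le:
  shows "\<bar>bump x\<bar> \<le> 12" "\<bar>bump_deriv x\<bar> \<le> 12" "\<bar>bump_deriv2 x\<bar> \<le> 12"
proof -
  have "\<bar>bump x\<bar> \<le> 12 \<and> \<bar>bump_deriv x\<bar> \<le> 12 \<and> \<bar>bump_deriv2 x\<bar> \<le> 12"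
  proof (cases "1 < x \<and> x < 2")
    case True
    define p where "p = max 0 ((x - 1) * (2 - x))"
    define r where "r = 3 - 2 * x"
    have p: "0 \<le> p" "p \<le> 1"
      using True mult_le_one[of "x - 1" "2 - x"] by (auto simp: p_def)
    have r: "\<bar>r\<bar> \<le> 1" using True by (auto simp: r_def)
    have p2: "p\<^sup>2 \<le> 1" "p ^ 3 \<le> 1" "r\<^sup>2 \<le> 1"
      using p r by (auto simp: power_le_one abs_square_le_1)
    have "\<bar>bump x\<bar> \<le> 12" using p p2 by (simp add: bump_def p_def[symmetric])
    moreover have "p\<^sup>2 * \<bar>r\<bar> \<le> 4" using mult_le_one[of "p\<^sup>2" "\<bar>r\<bar>"] p2 r by simp
    then have "\<bar>bump_deriv x\<bar> \<le> 12"
      unfolding bump_deriv_def p_def[symmetric] r_def[symmetric] by (simp add: abs_mult mult.commute)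
    moreover have "p * r\<^sup>2 \<le> 1" "0 \<le> p * r\<^sup>2" using mult_le_one[of p "r\<^sup>2"] p2 p by simp_all
    then have "\<bar>bump_deriv2 x\<bar> \<le> 12"
      unfolding bump_deriv2_def p_def[symmetric] r_def[symmetric]
      using p2 zero_le_power2[of p] by linarith
    ultimately show ?thesis by blast
  next
    case False
    then show ?thesis using bump_eq_0[of x] by auto
  qed
  then show "\<bar>bump x\<bar> \<le> 12" "\<bar>bump_deriv x\<bar> \<le> 12" "\<bar>bump_deriv2 x\<bar> \<le> 12" by auto
qed

lemma continuous_on_bump:
  "continuous_on A bump" "continuous_on A bump_deriv" "continuous_on A bump_deriv2"
  unfolding bump_def[abs_def] bump_deriv_def[abs_def] bump_deriv2_def[abs_def]
  by (intro continuous_intros)+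

lemma L1_norm_dilate_le:
  fixes g :: "real \<Rightarrow> real" and c :: real
  assumes bd: "\<And>x. \<bar>g x\<bar> \<le> M" and supp: "\<And>x. x \<le> 1 \<or> x \<ge> 2 \<Longrightarrow> g x = 0"
  shows "L1_norm (\<lambda>x. of_real (c * g (2 ^ j * x))) \<le> ennreal (\<bar>c\<bar> * M / 2 ^ j)"
proof -
  have M: "M \<ge> 0" using bd[of 0] by linarith
  have "L1_norm (\<lambda>x. of_real (c * g (2 ^ j * x)))
    \<le> (\<integral>\<^sup>+x. ennreal (\<bar>c\<bar> * M) * indicator {1 / 2 ^ j .. 2 / 2 ^ j :: real} x \<partial>lborel)"
    unfolding L1_norm_def
  proof (intro nn_integral_mono)
    fix x :: real
    have "ennreal (norm (complex_of_real (c * g (2 ^ j * x)))) \<le> ennreal (\<bar>c\<bar> * M) * indicator {1 / 2 ^ j .. 2 / 2 ^ j :: real} x"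
    proof (cases "x \<in> {1 / 2 ^ j .. 2 / 2 ^ j :: real}")
      case True
      then show ?thesis unfolding norm_of_real abs_mult by (auto intro!: ennreal_leI mult_left_mono bd)
    next
      case False
      then have "2 ^ j * x \<le> 1 \<or> 2 ^ j * x \<ge> 2" by (auto simp: field_simps)
      then show ?thesis by (simp add: supp)
    qed
    then show "ennreal (norm (complex_of_real (c * g (2 ^ j * x)))) * indicator {0..2 * pi} x
      \<le> ennreal (\<bar>c\<bar> * M) * indicator {1 / 2 ^ j .. 2 / 2 ^ j :: real} x"
      by (auto simp: indicator_def split: if_splits)
  qed
  also have "\<dots> = ennreal (\<bar>c\<bar> * M) * ennreal (2 / 2 ^ j - 1 / 2 ^ j)"
    by (subst nn_integral_cmult) (auto simp: divide_right_mono)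
  also have "\<dots> = ennreal (\<bar>c\<bar> * M / 2 ^ j)"
    using M by (subst ennreal_mult[symmetric]) (auto simp: field_simps)
  finally show ?thesis .
qed

text \<open>These functions have essentially disjoint supports $[2^{-j}, 2^{1-j}]$, so their norms add up. The
  weight $(j+1)^{-2}$ varies slowly enough to survive convolution with a geometric sequence.\<close>

definition wavelet :: "nat \<Rightarrow> real \<Rightarrow> complex" where
  "wavelet j x = of_real (2 ^ j / (real j + 1)\<^sup>2 * bump_deriv (2 ^ j * x))"

lemma wavelet_eq_0:
  assumes "2 ^ j * x \<le> 1 \<or> 2 ^ j * x \<ge> 2"
  shows "wavelet j x = 0"
  using bump_eq_0(2)[OF assms] by (simp add: wavelet_def)

lemma continuous_on_wavelet: "continuous_on A (wavelet j)"
  unfolding wavelet_def[abs_def]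
  by (intro continuous_intros continuous_on_compose2[OF continuous_on_bump(2)[of UNIV]]) auto

lemma set_integrable_wavelet: "set_integrable lborel {0..2 * pi} (wavelet j)"
  by (intro borel_integrable_atLeastAtMost' continuous_on_wavelet)

lemma borel_measurable_wavelet [measurable]: "wavelet j \<in> borel_measurable borel"
  by (intro borel_measurable_continuous_onI continuous_on_wavelet)

text \<open>With N = 2^k, writing the wavelet as F' costs N^{\<alpha>+1} times a norm of order
  2^{-j}; passing to its derivative G costs N^{\<alpha>-1} times a norm of order 2^j, which is where
  \<alpha> \<ge> 1 enters. The first bound is used for j \<ge> k, the second for j < k. With
  truncated subtraction the exponent (k - j) + (j - k) is |k - j|.\<close>

lemma vp_mean_wavelet_le:
  assumes \<eta>: "vp_cutoff \<eta>" and \<alpha>: "\<alpha> \<ge> 1"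
  obtains C where "C \<ge> 0"
    and "\<And>j k. k \<ge> 1 \<Longrightarrow> L1_norm (nth_derivative \<alpha> (vp_mean \<eta> (2 ^ k) (wavelet j)))
      \<le> ennreal (C * 2 ^ (\<alpha> * k) * (1 / (real j + 1)\<^sup>2 * (1 / 2) ^ ((k - j) + (j - k))))"
proof -
  obtain C1 where C1: "C1 \<ge> 0" "\<And>N (f :: real \<Rightarrow> complex). N \<ge> 2 \<Longrightarrow> set_integrable lborel {0..2 * pi} f \<Longrightarrow>
      L1_norm (nth_derivative (Suc \<alpha>) (vp_mean \<eta> N f)) \<le> ennreal (C1 * real N ^ Suc \<alpha>) * L1_norm f"
    using vp_mean_bernstein[OF \<eta>] by metis
  obtain C2 where C2: "C2 \<ge> 0" "\<And>N (f :: real \<Rightarrow> complex). N \<ge> 2 \<Longrightarrow> set_integrable lborel {0..2 * pi} f \<Longrightarrow>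
      L1_norm (nth_derivative (\<alpha> - 1) (vp_mean \<eta> N f)) \<le> ennreal (C2 * real N ^ (\<alpha> - 1)) * L1_norm f"
    using vp_mean_bernstein[OF \<eta>] by metis
  have pi4: "2 \<le> 2 * pi" using pi_ge_two by simp
  \<comment> \<open>Since 2^j * 2 pi \<ge> 2, dilates of functions supported in [1, 2] vanish at
    both ends of the period, which gives the equal end values that integration by parts asks
    for.\<close>
  have ends: "g 0 = 0 \<and> g (2 ^ j * (2 * pi)) = 0"
    if "\<And>x. x \<le> 1 \<or> x \<ge> 2 \<Longrightarrow> g x = 0" for g :: "real \<Rightarrow> real" and j :: nat
    using that mult_mono[of 1 "2 ^ j" 2 "2 * pi"] pi4 by simp
  show ?thesis
  proof (rule that[of "12 * (C1 + C2)"])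
    show "12 * (C1 + C2) \<ge> 0" using C1 C2 by simp
    fix j k :: nat assume k: "k \<ge> 1"
    let ?L = "L1_norm (nth_derivative \<alpha> (vp_mean \<eta> (2 ^ k) (wavelet j)))"
    let ?a = "(real j + 1)\<^sup>2"
    have N: "(2::nat) ^ k \<ge> 2" using power_increasing[of 1 k "2::nat"] k by simp
    then have N1: "(2::nat) ^ k \<ge> 1" by linarith
    define F where "F = (\<lambda>x. complex_of_real (1 / ?a * bump (2 ^ j * x)))"
    define G where "G = (\<lambda>x. complex_of_real (4 ^ j / ?a * bump_deriv2 (2 ^ j * x)))"
    have a0: "?a > 0" by simp
    have dF: "(F has_vector_derivative wavelet j x) (at x)" for x
    proof -
      have "((\<lambda>x. 1 / ?a * bump (2 ^ j * x)) has_real_derivative 1 / ?a * (bump_deriv (2 ^ j * x) * 2 ^ j)) (at x)"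
        by (intro DERIV_cmult DERIV_chain2[OF has_real_derivative_bump]) (auto intro!: derivative_eq_intros)
      then show ?thesis
        unfolding F_def wavelet_def
        by (intro has_vector_derivative_of_real)
          (simp add: has_real_derivative_iff_has_vector_derivative[symmetric] mult.commute)
    qed
    have dw: "(wavelet j has_vector_derivative G x) (at x)" for x
    proof -
      have "((\<lambda>x. 2 ^ j / ?a * bump_deriv (2 ^ j * x)) has_real_derivative
          2 ^ j / ?a * (bump_deriv2 (2 ^ j * x) * 2 ^ j)) (at x)"
        by (intro DERIV_cmult DERIV_chain2[OF has_real_derivative_bump_deriv]) (auto intro!: derivative_eq_intros)
      moreover have "2 ^ j / ?a * (bump_deriv2 (2 ^ j * x) * 2 ^ j) = 4 ^ j / ?a * bump_deriv2 (2 ^ j * x)"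
        by (simp add: power_mult_distrib[symmetric])
      ultimately show ?thesis
        unfolding G_def wavelet_def[abs_def]
        by (intro has_vector_derivative_of_real)
          (simp only: has_real_derivative_iff_has_vector_derivative[symmetric])
    qed
    have cF: "continuous_on A F" for A
      unfolding F_def
      by (intro continuous_intros continuous_on_compose2[OF continuous_on_bump(1)[of UNIV]]) auto
    have cG: "continuous_on A G" for A
      unfolding G_def
      by (intro continuous_intros continuous_on_compose2[OF continuous_on_bump(3)[of UNIV]]) auto
    have "?L = L1_norm (nth_derivative (Suc \<alpha>) (vp_mean \<eta> (2 ^ k) F))"
      using ends[of bump j] bump_eq_0(1)
      by (subst nth_derivative_vp_mean_deriv[OF \<eta> N1 dF continuous_on_wavelet]) (auto simp: F_def)
    also have "\<dots> \<le> ennreal (C1 * real (2 ^ k) ^ Suc \<alpha>) * L1_norm F"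
      by (intro C1 N borel_integrable_atLeastAtMost' cF)
    also have "\<dots> \<le> ennreal (C1 * real (2 ^ k) ^ Suc \<alpha>) * ennreal (\<bar>1 / ?a\<bar> * 12 / 2 ^ j)"
      unfolding F_def by (intro mult_left_mono L1_norm_dilate_le bump_le bump_eq_0) auto
    also have "\<dots> = ennreal (12 * C1 * 2 ^ (\<alpha> * k) / ?a * (2 ^ k / 2 ^ j))"
      using C1(1) a0 by (subst ennreal_mult[symmetric])
        (auto simp: power_mult[symmetric] power_add[symmetric] mult_ac)
    finally have up: "?L \<le> ennreal (12 * C1 * 2 ^ (\<alpha> * k) / ?a * (2 ^ k / 2 ^ j))" .
    have "?L = L1_norm (nth_derivative (\<alpha> - 1) (vp_mean \<eta> (2 ^ k) G))"
      using ends[of bump_deriv j] bump_eq_0(2) \<alpha>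
      by (subst nth_derivative_vp_mean_deriv[OF \<eta> N1 dw cG]) (auto simp: wavelet_def)
    also have "\<dots> \<le> ennreal (C2 * real (2 ^ k) ^ (\<alpha> - 1)) * L1_norm G"
      by (intro C2 N borel_integrable_atLeastAtMost' cG)
    also have "\<dots> \<le> ennreal (C2 * real (2 ^ k) ^ (\<alpha> - 1)) * ennreal (\<bar>4 ^ j / ?a\<bar> * 12 / 2 ^ j)"
      unfolding G_def by (intro mult_left_mono L1_norm_dilate_le bump_le bump_eq_0) auto
    also have "\<dots> = ennreal (12 * C2 * 2 ^ (\<alpha> * k) / ?a * (2 ^ j / 2 ^ k))"
    proof -
      have "(4::real) ^ j = 2 ^ j * 2 ^ j" by (simp add: power_mult_distrib[symmetric])
      moreover have "real (2 ^ k) ^ (\<alpha> - 1) = 2 ^ (\<alpha> * k) / 2 ^ k"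
        using \<alpha> by (cases \<alpha>) (auto simp: power_add power_mult[symmetric] mult.commute)
      ultimately show ?thesis
        using C2(1) a0 by (subst ennreal_mult[symmetric]) (auto simp: field_simps)
    qed
    finally have down: "?L \<le> ennreal (12 * C2 * 2 ^ (\<alpha> * k) / ?a * (2 ^ j / 2 ^ k))" .
    have fin: "ennreal (12 * C * 2 ^ (\<alpha> * k) / ?a * t)
      \<le> ennreal (12 * (C1 + C2) * 2 ^ (\<alpha> * k) * (1 / ?a * t))"
      if "C \<le> C1 + C2" "t \<ge> 0" for C t
    proof (rule ennreal_leI)
      have "12 * C * 2 ^ (\<alpha> * k) * (1 / ?a * t) \<le> 12 * (C1 + C2) * 2 ^ (\<alpha> * k) * (1 / ?a * t)"
        using that by (intro mult_right_mono) auto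
      then show "12 * C * 2 ^ (\<alpha> * k) / ?a * t \<le> 12 * (C1 + C2) * 2 ^ (\<alpha> * k) * (1 / ?a * t)" by simp
    qed
    show "?L \<le> ennreal (12 * (C1 + C2) * 2 ^ (\<alpha> * k) * (1 / ?a * (1 / 2) ^ ((k - j) + (j - k))))"
    proof (cases "j \<ge> k")
      case True
      then have "(2::real) ^ k / 2 ^ j = (1 / 2) ^ ((k - j) + (j - k))"
        by (simp add: power_diff power_one_over)
      then show ?thesis using up fin[of C1 "2 ^ k / 2 ^ j"] C2(1) by (auto intro: order_trans)
    next
      case False
      then have "(2::real) ^ j / 2 ^ k = (1 / 2) ^ ((k - j) + (j - k))"
        by (simp add: power_diff power_one_over)
      then show ?thesis using down fin[of C2 "2 ^ j / 2 ^ k"] C1(1) by (auto intro: order_trans)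
    qed
  qed
qed

section \<open>Convolutions and tails of inverse squares\<close>

lemma inverse_square_geometric_convolution:
  obtains C :: real where "C \<ge> 0"
    and "\<And>k::nat. (\<Sum>j. ennreal (1 / (real j + 1)\<^sup>2 * (1 / 2) ^ ((k - j) + (j - k)))) \<le> ennreal (C / (real k + 1)\<^sup>2)"
proof -
  \<comment> \<open>The price of replacing (j+1)^{-2} by (k+1)^{-2} is a polynomial in the distance
    of j and k; times the geometric factor it is still summable.\<close>
  define g where "g = (\<lambda>i::nat. (real i + 1)\<^sup>2 * (1 / 2) ^ i)"
  have "summable g"
  proof (rule summable_ratio_test[of "3 / 4" 4])
    fix n :: nat assume "4 \<le> n"
    then have n: "4 \<le> real n" by simp
    \<comment> \<open>This reads n^2 - 2n - 8 \<ge> 0, slightly more than the n^2 - 2n - 5 \<ge> 0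
      that the ratio 3/4 requires.\<close>
    then have "0 \<le> (real n - 4) * (real n + 2)" by (intro mult_nonneg_nonneg) auto
    then have "2 * (real n + 2)\<^sup>2 \<le> 3 * (real n + 1)\<^sup>2"
      by (simp add: power2_eq_square algebra_simps)
    then have "2 * (real n + 2)\<^sup>2 * (1 / 2) ^ n \<le> 3 * (real n + 1)\<^sup>2 * (1 / 2) ^ n"
      by (rule mult_right_mono) simp
    then show "norm (g (Suc n)) \<le> 3 / 4 * norm (g n)"
      by (simp add: g_def algebra_simps)
  qed simp
  have g0: "g i \<ge> 0" for i by (simp add: g_def)
  let ?d = "\<lambda>k j. (k - j) + (j - k) :: nat"
  \<comment> \<open>Each distance to k occurs at most twice, once on either side. The index k is
    counted on both sides, which only enlarges the bound.\<close>
  have sum: "(\<Sum>j<n. g (?d k j)) \<le> 2 * suminf g" for n k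
  proof -
    have "(\<Sum>j<n. g (?d k j)) \<le> (\<Sum>j\<in>{..k} \<union> {k..<n}. g (?d k j))"
      by (intro sum_mono2) (auto simp: g0)
    also have "\<dots> \<le> (\<Sum>j\<in>{..k}. g (?d k j)) + (\<Sum>j\<in>{k..<n}. g (?d k j))"
      by (subst sum_Un) (auto simp: g0 sum_nonneg)
    also have "(\<Sum>j\<in>{..k}. g (?d k j)) = sum g {..k}"
      by (rule sum.reindex_bij_witness[of _ "\<lambda>i. k - i" "\<lambda>j. k - j"]) auto
    also have "(\<Sum>j\<in>{k..<n}. g (?d k j)) = sum g {..<n - k}"
      by (rule sum.reindex_bij_witness[of _ "\<lambda>i. i + k" "\<lambda>j. j - k"]) auto
    also have "sum g {..k} + sum g {..<n - k} \<le> suminf g + suminf g"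
      by (intro add_mono sum_le_suminf \<open>summable g\<close>) (auto simp: g0)
    finally show ?thesis by simp
  qed
  have pt: "1 / (real j + 1)\<^sup>2 * (1 / 2) ^ ?d k j \<le> g (?d k j) / (real k + 1)\<^sup>2" for j k
  proof -
    \<comment> \<open>A discrete form of Peetre's inequality.\<close>
    have "k + 1 \<le> (j + 1) * (?d k j + 1)"
    proof (cases "j \<le> k")
      case True
      then obtain i where "k = j + i" using le_Suc_ex by blast
      then show ?thesis by simp
    qed (simp add: algebra_simps)
    then have "real (k + 1) \<le> real ((j + 1) * (?d k j + 1))" by (rule of_nat_mono)
    then have "real k + 1 \<le> (real j + 1) * (real (?d k j) + 1)" by (simp only: of_nat_mult of_nat_add of_nat_1)
    then have "(real k + 1)\<^sup>2 \<le> ((real j + 1) * (real (?d k j) + 1))\<^sup>2" by (intro power_mono) auto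
    then have "(real k + 1)\<^sup>2 * (1 / 2) ^ ?d k j \<le> (real j + 1)\<^sup>2 * g (?d k j)"
      unfolding g_def power_mult_distrib by (simp add: mult.assoc[symmetric])
    then show ?thesis by (simp add: divide_simps mult_ac)
  qed
  show ?thesis
  proof (rule that[of "2 * suminf g"])
    show "2 * suminf g \<ge> 0" using suminf_nonneg[OF \<open>summable g\<close> g0] by simp
    fix k :: nat
    show "(\<Sum>j. ennreal (1 / (real j + 1)\<^sup>2 * (1 / 2) ^ ?d k j)) \<le> ennreal (2 * suminf g / (real k + 1)\<^sup>2)"
    proof (rule suminf_le_const[OF summableI])
      fix n
      have "(\<Sum>j<n. ennreal (1 / (real j + 1)\<^sup>2 * (1 / 2) ^ ?d k j))
        = ennreal (\<Sum>j<n. 1 / (real j + 1)\<^sup>2 * (1 / 2) ^ ?d k j)"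
        by (rule sum_ennreal) simp
      also have "\<dots> \<le> ennreal ((\<Sum>j<n. g (?d k j)) / (real k + 1)\<^sup>2)"
        unfolding sum_divide_distrib by (intro ennreal_leI sum_mono pt)
      also have "\<dots> \<le> ennreal (2 * suminf g / (real k + 1)\<^sup>2)"
        by (intro ennreal_leI divide_right_mono sum) auto
      finally show "(\<Sum>j<n. ennreal (1 / (real j + 1)\<^sup>2 * (1 / 2) ^ ?d k j))
        \<le> ennreal (2 * suminf g / (real k + 1)\<^sup>2)" .
    qed
  qed
qed

text \<open>Telescoping: with m = n + 1 + j, compare 1/m^2 to 1/(m - 1) - 1/m.\<close>

lemma suminf_inverse_square_tail_le:
  assumes "n \<ge> 1"
  shows "(\<Sum>j. ennreal (1 / (real (n + 1 + j))\<^sup>2)) \<le> ennreal (1 / real n)"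
proof (rule suminf_le_const[OF summableI])
  fix m
  have pt: "1 / (real (n + 1 + j))\<^sup>2 \<le> 1 / real (n + j) - 1 / real (n + Suc j)" for j
  proof -
    have "1 / real (n + j) - 1 / real (n + Suc j) = 1 / (real (n + j) * real (n + 1 + j))"
      using assms by (simp add: field_simps)
    also have "\<dots> \<ge> 1 / (real (n + 1 + j))\<^sup>2"
      unfolding power2_eq_square using assms by (intro divide_left_mono mult_right_mono) auto
    finally show ?thesis .
  qed
  have "(\<Sum>j<m. ennreal (1 / (real (n + 1 + j))\<^sup>2)) = ennreal (\<Sum>j<m. 1 / (real (n + 1 + j))\<^sup>2)"
    by (rule sum_ennreal) simp
  also have "\<dots> \<le> ennreal (\<Sum>j<m. 1 / real (n + j) - 1 / real (n + Suc j))"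
    by (intro ennreal_leI sum_mono pt)
  also have "\<dots> \<le> ennreal (1 / real n)"
    by (intro ennreal_leI, subst sum_lessThan_telescope') simp
  finally show "(\<Sum>j<m. ennreal (1 / (real (n + 1 + j))\<^sup>2)) \<le> ennreal (1 / real n)" .
qed

section \<open>Disjointness of the supports\<close>

lemma wavelet_disjoint:
  assumes "wavelet i x \<noteq> 0" "wavelet j x \<noteq> 0"
  shows "i = j"
proof (rule ccontr)
  have supp: "1 < 2 ^ l * x \<and> 2 ^ l * x < 2" if "wavelet l x \<noteq> 0" for l
    using wavelet_eq_0[of l x] that by linarith
  have lt: False if "l < m" "wavelet l x \<noteq> 0" "wavelet m x \<noteq> 0" for l m
  proof -
    have "x > 0" using supp[OF that(2)] by (meson less_trans zero_less_mult_pos zero_less_one zero_less_power zero_less_numeral)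
    moreover have "(2::real) ^ m \<ge> 2 * 2 ^ l"
      using that(1) power_increasing[of "Suc l" m "2::real"] by simp
    ultimately have "2 ^ m * x \<ge> 2 * 2 ^ l * x" by (intro mult_right_mono) auto
    then show False using supp[OF that(2)] supp[OF that(3)] by linarith
  qed
  assume "i \<noteq> j"
  then show False using lt assms by (meson linorder_neqE_nat)
qed

lemma wavelet_at_most_one:
  obtains i where "\<And>j. j \<noteq> i \<Longrightarrow> wavelet j x = 0"
  using wavelet_disjoint by metis

lemma summable_norm_wavelet: "summable (\<lambda>j. norm (wavelet j x))"
proof -
  obtain i where "\<And>j. j \<noteq> i \<Longrightarrow> wavelet j x = 0" using wavelet_at_most_one[of x] by blast
  then show ?thesis by (intro summable_finite[of "{i}"]) auto
qed

text \<open>At most one term is nonzero, so nothing cancels. This equality is what turns the L1 norm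
  into an l^1 sum over the scales.\<close>

lemma norm_suminf_wavelet: "ennreal (norm (\<Sum>j. wavelet j x)) = (\<Sum>j. ennreal (norm (wavelet j x)))"
proof -
  obtain i where i: "\<And>j. j \<noteq> i \<Longrightarrow> wavelet j x = 0" using wavelet_at_most_one[of x] by blast
  have "(\<Sum>j. wavelet j x) = wavelet i x"
    by (subst suminf_finite[where N = "{i}"]) (simp_all add: i)
  moreover have "(\<Sum>j. ennreal (norm (wavelet j x))) = ennreal (norm (wavelet i x))"
    by (subst suminf_finite[where N = "{i}"]) (simp_all add: i)
  ultimately show ?thesis by simp
qed

lemma L1_norm_wavelet_le: "L1_norm (wavelet j) \<le> ennreal (12 / (real j + 1)\<^sup>2)"
proof -
  have "L1_norm (wavelet j) \<le> ennreal (\<bar>2 ^ j / (real j + 1)\<^sup>2\<bar> * 12 / 2 ^ j)"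
    unfolding wavelet_def[abs_def] by (intro L1_norm_dilate_le bump_le bump_eq_0)
  then show ?thesis by simp
qed

lemma suminf_L1_norm_wavelet: "(\<Sum>j. L1_norm (wavelet j)) < \<infinity>"
proof -
  have "(\<Sum>j. L1_norm (wavelet j)) \<le> (\<Sum>j. ennreal (12 / (real j + 1)\<^sup>2))"
    by (intro suminf_le L1_norm_wavelet_le summableI)
  also have "\<dots> < \<infinity>"
  proof -
    have "summable (\<lambda>j. 12 * inverse ((real (Suc j))\<^sup>2))"
      using inverse_power_summable[of 2, where 'a = real]
      by (intro summable_mult) (subst summable_Suc_iff, simp)
    moreover have "12 * inverse ((real (Suc j))\<^sup>2) = 12 / (real j + 1)\<^sup>2" for j
      by (simp add: divide_inverse add.commute)
    ultimately have "summable (\<lambda>j. 12 / (real j + 1)\<^sup>2)" by (simp only:)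
    then have "(\<Sum>j. ennreal (12 / (real j + 1)\<^sup>2)) \<noteq> top"
      by (rule ennreal_suminf_neq_top) simp
    then show ?thesis by (simp only: less_top infinity_ennreal_def)
  qed
  finally show ?thesis .
qed

text \<open>The wavelet has integral 0 over its support, so only the left half is used: there the
  antiderivative rises from 0 to the maximum 1/64 of the bump, times the weight. For j > n this half
  lies inside the interval.\<close>

lemma nn_integral_wavelet_ge:
  assumes "j > n"
  shows "(\<integral>\<^sup>+x\<in>{0<..<1 / 2 ^ n}. ennreal (norm (wavelet j x)) \<partial>lborel) \<ge> ennreal (1 / (64 * (real j + 1)\<^sup>2))"
proof -
  let ?a = "(real j + 1)\<^sup>2"
  let ?F = "\<lambda>x. 1 / ?a * bump (2 ^ j * x)"
  let ?f = "\<lambda>x. 2 ^ j / ?a * bump_deriv (2 ^ j * x)"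
  let ?I = "{1 / 2 ^ j..3 / 2 / 2 ^ j :: real}"
  have F: "(?F has_real_derivative ?f x) (at x)" for x
    by (rule DERIV_cong[OF DERIV_cmult[OF DERIV_chain2[OF has_real_derivative_bump]]])
      (auto intro!: derivative_eq_intros)
  have cont: "continuous_on A ?f" for A
    by (intro continuous_intros continuous_on_compose2[OF continuous_on_bump(2)[of UNIV]]) auto
  have int: "integrable lborel (\<lambda>x. indicator ?I x *\<^sub>R ?f x)"
    using borel_integrable_atLeastAtMost'[OF cont] unfolding set_integrable_def .
  have "(LINT x|lborel. indicator ?I x *\<^sub>R ?f x) = ?F (3 / 2 / 2 ^ j) - ?F (1 / 2 ^ j)"
  proof (rule integral_FTC_atLeastAtMost[OF _ _ cont])
    show "1 / 2 ^ j \<le> (3 / 2 / 2 ^ j :: real)" by (intro divide_right_mono) auto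
    show "(?F has_vector_derivative ?f x) (at x within ?I)" for x
      using has_field_derivative_at_within[OF F]
      unfolding has_real_derivative_iff_has_vector_derivative .
  qed
  also have "\<dots> = 1 / (64 * ?a)"
    by (simp add: bump_def power_divide)
  finally have "ennreal (1 / (64 * ?a)) = ennreal (norm (LINT x|lborel. indicator ?I x *\<^sub>R ?f x))" by simp
  also have "\<dots> \<le> (\<integral>\<^sup>+x. ennreal (norm (indicator ?I x *\<^sub>R ?f x)) \<partial>lborel)"
    by (rule integral_norm_bound_ennreal[OF int])
  also have "\<dots> \<le> (\<integral>\<^sup>+x\<in>{0<..<1 / 2 ^ n}. ennreal (norm (wavelet j x)) \<partial>lborel)"
  proof (intro nn_integral_mono)
    fix x :: real
    have "2 * 2 ^ n \<le> (2::real) ^ j" using power_increasing[of "Suc n" j "2::real"] assms by simp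
    moreover have "(0::real) < 2 ^ n" by simp
    ultimately have "3 * 2 ^ n < 2 * (2::real) ^ j" by linarith
    then have "3 / 2 / (2::real) ^ j < 1 / 2 ^ n" by (simp add: field_simps)
    moreover have "0 < 1 / (2::real) ^ j" by simp
    ultimately have sub: "x \<in> {0<..<1 / 2 ^ n}" if "x \<in> ?I"
      using that unfolding atLeastAtMost_iff greaterThanLessThan_iff by linarith
    show "ennreal (norm (indicator ?I x *\<^sub>R ?f x)) \<le> ennreal (norm (wavelet j x)) * indicator {0<..<1 / 2 ^ n} x"
    proof (cases "x \<in> ?I")
      case True
      then have "indicator ?I x = (1::real)" "indicator {0<..<1 / 2 ^ n} x = (1::ennreal)"
        using sub by simp_all
      then show ?thesis
        unfolding wavelet_def norm_of_real by (simp only: scaleR_one real_norm_def mult_1_right order_refl)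
    next
      case False
      then have "indicator ?I x = (0::real)" by (rule indicator_simps(2))
      then show ?thesis by (simp only: scaleR_zero_left norm_zero ennreal_0 zero_le)
    qed
  qed
  finally show ?thesis .
qed

section \<open>The periodic function and its modulus of smoothness\<close>

definition lacunary_sum :: "real \<Rightarrow> complex" where
  "lacunary_sum x = (\<Sum>j. wavelet j (x - 2 * pi * of_int \<lfloor>x / (2 * pi)\<rfloor>))"

lemma lacunary_sum_periodic: "lacunary_sum (x + 2 * pi) = lacunary_sum x"
proof -
  have "(x + 2 * pi) / (2 * pi) = x / (2 * pi) + 1" by (simp add: add_divide_distrib)
  then have "\<lfloor>(x + 2 * pi) / (2 * pi)\<rfloor> = \<lfloor>x / (2 * pi)\<rfloor> + 1" by simp
  then show ?thesis by (simp add: lacunary_sum_def algebra_simps)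
qed

lemma lacunary_sum_base:
  assumes "0 \<le> x" "x \<le> 2 * pi"
  shows "lacunary_sum x = (\<Sum>j. wavelet j x)"
proof (cases "x = 2 * pi")
  case True
  \<comment> \<open>The floor sends the endpoint 2 pi to 0; the two values agree because every
    wavelet vanishes at both points.\<close>
  have "2 ^ j * (2 * pi) \<ge> 2" for j :: nat
    using mult_mono[of 1 "2 ^ j" 2 "2 * pi"] pi_ge_two by simp
  then show ?thesis using True by (simp add: lacunary_sum_def wavelet_eq_0)
next
  case False
  then have "\<lfloor>x / (2 * pi)\<rfloor> = 0" using assms by (simp add: floor_eq_iff)
  then show ?thesis by (simp add: lacunary_sum_def)
qed

text \<open>All wavelets live in [0, 2], while x + 2 pi \<ge> 2 pi - 1 > 2. This gap of length 1 to
  the left of 0 is the room for iterated differences.\<close>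

lemma lacunary_sum_negative:
  assumes "- 1 \<le> x" "x < 0"
  shows "lacunary_sum x = 0"
proof -
  have "2 ^ j * (x + 2 * pi) \<ge> 2" for j :: nat
    using mult_mono[of 1 "2 ^ j" 2 "x + 2 * pi"] pi_ge_two assms by simp
  then have "(\<Sum>j. wavelet j (x + 2 * pi)) = 0" by (simp add: wavelet_eq_0)
  moreover have "lacunary_sum x = (\<Sum>j. wavelet j (x + 2 * pi))"
    using assms pi_ge_two by (subst lacunary_sum_periodic[symmetric], intro lacunary_sum_base) auto
  ultimately show ?thesis by simp
qed

lemma lacunary_sum_in_L1_torus: "lacunary_sum \<in> L1_torus"
proof -
  have "set_integrable lborel {0..2 * pi} lacunary_sum"
    by (rule set_integrable_suminf[OF set_integrable_wavelet suminf_L1_norm_wavelet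
          summable_norm_wavelet lacunary_sum_base])
  then show ?thesis by (simp add: L1_torus_def lacunary_sum_periodic)
qed

text \<open>Differences are taken to the left, where \<open>lacunary_sum\<close> vanishes, so that on $(0,\delta)$ the
  iterated difference is the function itself up to sign.\<close>

lemma fwd_diff_power_vanishing_left:
  assumes "\<And>y. - 1 \<le> y \<Longrightarrow> y < 0 \<Longrightarrow> f y = 0" and "\<delta> > 0"
  shows "real m * \<delta> \<le> 1 \<Longrightarrow> - 1 + real m * \<delta> \<le> y \<Longrightarrow> y < \<delta> \<Longrightarrow>
    (fwd_diff (- \<delta>) ^^ m) f y = (if y < 0 then 0 else (- 1) ^ m * f y)"
proof (induction m arbitrary: y)
  case 0
  then show ?case using assms(1) by simp
next
  case (Suc m)
  \<comment> \<open>As y < \<delta>, the point y - \<delta> is negative and its term vanishes by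
    induction; what remains is the m-th difference at y with the opposite sign.\<close>
  have "(fwd_diff (- \<delta>) ^^ Suc m) f y = (fwd_diff (- \<delta>) ^^ m) f (y - \<delta>) - (fwd_diff (- \<delta>) ^^ m) f y"
    by (simp add: fwd_diff_def)
  moreover have "real m * \<delta> \<le> 1" "- 1 + real m * \<delta> \<le> y - \<delta>" "- 1 + real m * \<delta> \<le> y"
    using Suc.prems \<open>\<delta> > 0\<close> by (auto simp: algebra_simps)
  ultimately show ?case
    using Suc.IH[of "y - \<delta>"] Suc.IH[of y] Suc.prems \<open>\<delta> > 0\<close> by auto
qed

lemma modulus_smoothness_lacunary_sum_ge:
  assumes "n \<ge> 1" "real \<alpha> \<le> 2 ^ n"
  shows "modulus_smoothness \<alpha> lacunary_sum (2 powr - real n) \<ge> ennreal (1 / (576 * real n))"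
proof -
  let ?\<delta> = "1 / 2 ^ n :: real"
  have \<delta>: "2 powr - real n = ?\<delta>"
    by (simp add: powr_minus powr_realpow inverse_eq_divide)
  have \<delta>1: "?\<delta> \<le> 2 * pi"
  proof -
    have "?\<delta> \<le> 1" by simp
    then show ?thesis using pi_ge_two by linarith
  qed
  have "ennreal (1 / (576 * real n)) \<le> ennreal (\<Sum>j\<in>{n<..2 * n}. 1 / (64 * (real j + 1)\<^sup>2))"
  proof (rule ennreal_leI)
    have "1 / (576 * real n) = (\<Sum>j\<in>{n<..2 * n}. 1 / (64 * (3 * real n)\<^sup>2))"
      using assms(1) by (simp add: power2_eq_square)
    also have "\<dots> \<le> (\<Sum>j\<in>{n<..2 * n}. 1 / (64 * (real j + 1)\<^sup>2))"
      using assms(1) by (intro sum_mono divide_left_mono mult_left_mono power_mono) auto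
    finally show "1 / (576 * real n) \<le> (\<Sum>j\<in>{n<..2 * n}. 1 / (64 * (real j + 1)\<^sup>2))" .
  qed
  also have "\<dots> = (\<Sum>j\<in>{n<..2 * n}. ennreal (1 / (64 * (real j + 1)\<^sup>2)))"
    by (rule sum_ennreal[symmetric]) simp
  also have "\<dots> \<le> (\<Sum>j\<in>{n<..2 * n}. \<integral>\<^sup>+x\<in>{0<..<?\<delta>}. ennreal (norm (wavelet j x)) \<partial>lborel)"
    by (intro sum_mono nn_integral_wavelet_ge) auto
  also have "\<dots> \<le> (\<Sum>j. \<integral>\<^sup>+x\<in>{0<..<?\<delta>}. ennreal (norm (wavelet j x)) \<partial>lborel)"
    by (intro sum_le_suminf summableI) auto
  also have "\<dots> = (\<integral>\<^sup>+x. (\<Sum>j. ennreal (norm (wavelet j x)) * indicator {0<..<?\<delta>} x) \<partial>lborel)"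
    by (intro nn_integral_suminf[symmetric]) measurable
  also have "\<dots> \<le> L1_norm ((fwd_diff (- ?\<delta>) ^^ \<alpha>) lacunary_sum)"
    unfolding L1_norm_def
  proof (intro nn_integral_mono)
    fix x :: real
    show "(\<Sum>j. ennreal (norm (wavelet j x)) * indicator {0<..<?\<delta>} x)
      \<le> ennreal (norm ((fwd_diff (- ?\<delta>) ^^ \<alpha>) lacunary_sum x)) * indicator {0..2 * pi} x"
    proof (cases "x \<in> {0<..<?\<delta>}")
      case True
      \<comment> \<open>The \<alpha> steps of length 2^{-n} have to fit into the gap of length
        1.\<close>
      have le1: "real \<alpha> * ?\<delta> \<le> 1" using assms(2) by simp
      have "(fwd_diff (- ?\<delta>) ^^ \<alpha>) lacunary_sum x = (- 1) ^ \<alpha> * lacunary_sum x"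
      proof -
        have "- 1 + real \<alpha> * ?\<delta> \<le> x"
          using le1 True unfolding greaterThanLessThan_iff by linarith
        from fwd_diff_power_vanishing_left[where f = lacunary_sum, OF lacunary_sum_negative _ le1 this]
        show ?thesis using True by simp
      qed
      then have "norm ((fwd_diff (- ?\<delta>) ^^ \<alpha>) lacunary_sum x) = norm (\<Sum>j. wavelet j x)"
        using True \<delta>1 lacunary_sum_base[of x] by (simp add: norm_mult norm_power)
      then show ?thesis using True \<delta>1 by (simp add: norm_suminf_wavelet)
    qed simp
  qed
  also have "\<dots> \<le> modulus_smoothness \<alpha> lacunary_sum (2 powr - real n)"
    unfolding modulus_smoothness_def \<delta> by (intro SUP_upper) simp
  finally show ?thesis .
qed

lemma vp_mean_lacunary_sum_le:
  assumes \<eta>: "vp_cutoff \<eta>" and \<alpha>: "\<alpha> \<ge> 1"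
  obtains C where "C > 0" and "\<And>k. k \<ge> 1 \<Longrightarrow>
    L1_norm (nth_derivative \<alpha> (vp_mean \<eta> (2 ^ k) lacunary_sum)) \<le> ennreal (2 ^ (\<alpha> * k) * (C / (real k + 1)\<^sup>2))"
proof -
  obtain C1 where C1: "C1 \<ge> 0" "\<And>j k. k \<ge> 1 \<Longrightarrow> L1_norm (nth_derivative \<alpha> (vp_mean \<eta> (2 ^ k) (wavelet j)))
      \<le> ennreal (C1 * 2 ^ (\<alpha> * k) * (1 / (real j + 1)\<^sup>2 * (1 / 2) ^ ((k - j) + (j - k))))"
    using vp_mean_wavelet_le[OF \<eta> \<alpha>] by blast
  obtain C2 :: real where C2: "C2 \<ge> 0"
    "\<And>k::nat. (\<Sum>j. ennreal (1 / (real j + 1)\<^sup>2 * (1 / 2) ^ ((k - j) + (j - k)))) \<le> ennreal (C2 / (real k + 1)\<^sup>2)"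
    using inverse_square_geometric_convolution by blast
  show ?thesis
  \<comment> \<open>Adding 1 keeps the constant positive even if C1 or C2 is 0; positivity is wanted
    when real powers are taken.\<close>
  proof (rule that[of "C1 * C2 + 1"])
    show "C1 * C2 + 1 > 0" using C1 C2 by (simp add: add_nonneg_pos)
    fix k :: nat assume k: "k \<ge> 1"
    have "L1_norm (nth_derivative \<alpha> (vp_mean \<eta> (2 ^ k) lacunary_sum))
      \<le> (\<Sum>j. L1_norm (nth_derivative \<alpha> (vp_mean \<eta> (2 ^ k) (wavelet j))))"
      by (rule L1_norm_vp_mean_suminf_le[OF set_integrable_wavelet suminf_L1_norm_wavelet
            summable_norm_wavelet lacunary_sum_base \<eta>]) auto
    also have "\<dots> \<le> (\<Sum>j. ennreal (C1 * 2 ^ (\<alpha> * k)) * ennreal (1 / (real j + 1)\<^sup>2 * (1 / 2) ^ ((k - j) + (j - k))))"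
      by (intro suminf_le summableI order_trans[OF C1(2)[OF k]])
        (subst ennreal_mult[symmetric], use C1(1) in auto)
    also have "\<dots> = ennreal (C1 * 2 ^ (\<alpha> * k)) * (\<Sum>j. ennreal (1 / (real j + 1)\<^sup>2 * (1 / 2) ^ ((k - j) + (j - k))))"
      by (rule ennreal_suminf_cmult)
    also have "\<dots> \<le> ennreal (C1 * 2 ^ (\<alpha> * k)) * ennreal (C2 / (real k + 1)\<^sup>2)"
      by (intro mult_left_mono C2) auto
    also have "\<dots> = ennreal (2 ^ (\<alpha> * k) * (C1 * C2 / (real k + 1)\<^sup>2))"
      using C1 C2 by (subst ennreal_mult[symmetric]) (auto simp: mult_ac)
    also have "\<dots> \<le> ennreal (2 ^ (\<alpha> * k) * ((C1 * C2 + 1) / (real k + 1)\<^sup>2))"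
      by (intro ennreal_leI mult_left_mono divide_right_mono) auto
    finally show "L1_norm (nth_derivative \<alpha> (vp_mean \<eta> (2 ^ k) lacunary_sum))
      \<le> ennreal (2 ^ (\<alpha> * k) * ((C1 * C2 + 1) / (real k + 1)\<^sup>2))" .
  qed
qed

section \<open>Real powers and the comparison of the two rates\<close>

lemma weighted_powr_le:
  fixes B q :: real and n k \<alpha> :: nat
  assumes B: "B > 0" and q: "q > 1" and n: "n \<ge> 1" "n \<le> k"
  shows "2 powr (- q * real \<alpha> * real k) * (2 ^ (\<alpha> * k) * (B / (real k + 1)\<^sup>2)) powr q
    \<le> B powr q * real n powr (2 - 2 * q) * (1 / (real k)\<^sup>2)"
proof -
  have k: "real k > 0" using n by simp
  define b where "b = B / (real k + 1)\<^sup>2"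
  have b: "b > 0" using B by (simp add: b_def)
  have e: "(2::real) ^ (\<alpha> * k) = 2 powr (real \<alpha> * real k)"
    using powr_realpow[of 2 "\<alpha> * k"] by (simp only: of_nat_mult)
  have "(2 ^ (\<alpha> * k) * b) powr q = (2 powr (real \<alpha> * real k)) powr q * b powr q"
    unfolding e by (rule powr_mult)
  also have "(2 powr (real \<alpha> * real k)) powr q = 2 powr (q * real \<alpha> * real k)"
    by (simp add: powr_powr mult_ac)
  finally have "2 powr (- q * real \<alpha> * real k) * (2 ^ (\<alpha> * k) * b) powr q
    = (2 powr (- (q * real \<alpha> * real k)) * 2 powr (q * real \<alpha> * real k)) * b powr q"
    by (simp only: mult.assoc mult_minus_left)
  also have "\<dots> = b powr q"
    unfolding powr_add[symmetric] by simp
  also have "\<dots> \<le> (B / (real k)\<^sup>2) powr q"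
  proof -
    have "b \<le> B / (real k)\<^sup>2"
      unfolding b_def using B k by (intro divide_left_mono power_mono) auto
    then show ?thesis using b q by (intro powr_mono2) auto
  qed
  also have "\<dots> = B powr q / real k powr (2 * q)"
  proof -
    have "(real k)\<^sup>2 = real k powr 2" using k by simp
    then have "((real k)\<^sup>2) powr q = real k powr (2 * q)" by (simp only: powr_powr)
    then show ?thesis by (simp only: powr_divide)
  qed
  \<comment> \<open>Once k^{-2} is split off, the remaining exponent 2 - 2q is negative, so that
    factor is largest at k = n. What is left to sum has exponent 2 for every q, and its tail
    telescopes.\<close>
  also have "\<dots> = B powr q * real k powr (2 - 2 * q) * (1 / (real k)\<^sup>2)"
  proof -
    have "real k powr (2 - 2 * q) = real k powr 2 / real k powr (2 * q)" by (rule powr_diff)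
    then show ?thesis using k by simp
  qed
  also have "\<dots> \<le> B powr q * real n powr (2 - 2 * q) * (1 / (real k)\<^sup>2)"
    using n q by (intro mult_left_mono mult_right_mono powr_mono2') auto
  finally show ?thesis unfolding b_def .
qed

lemma powr_two_minus_divide:
  fixes x q :: real
  assumes "x > 0"
  shows "x powr (2 - 2 * q) * (1 / x) = x powr (1 - 2 * q)"
proof -
  have "x powr (2 - 2 * q) = x powr (1 - 2 * q) * x powr 1"
    unfolding powr_add[symmetric] by simp
  then show ?thesis using assms by simp
qed

lemma powr_product_root:
  fixes B x q :: real
  assumes "B > 0" "x > 0" "q > 0"
  shows "(B powr q * x powr (1 - 2 * q)) powr (1 / q) = B * x powr (1 / q - 2)"
proof -
  have "(1 - 2 * q) * (1 / q) = 1 / q - 2" "q * (1 / q) = 1" using assms by (auto simp: field_simps)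
  then show ?thesis
    using assms by (simp only: powr_mult powr_powr powr_one)
qed

text \<open>The quotient of the two rates is n^{-p} with p = 1 - 1/q, positive because q > 1; hence
  a large n defeats any constant.\<close>

lemma reciprocal_not_le_powr:
  fixes K q :: real
  assumes q: "q > 1"
  obtains n :: nat where "n \<ge> m" "K * real n powr (1 / q - 2) < 1 / (576 * real n)"
proof -
  define p where "p = 1 - 1 / q"
  have p: "p > 0" using q by (simp add: p_def)
  define M where "M = 576 * \<bar>K\<bar> + 1"
  have M: "M > 0" by (simp add: M_def add_nonneg_pos)
  \<comment> \<open>The first summand forces n^p \<ge> M > 576 K, the second n \<ge> m, the last n >
    0.\<close>
  define n where "n = nat \<lceil>M powr (1 / p)\<rceil> + m + 1"
  have "n > 0" by (simp add: n_def)
  then have n: "real n > 0" by simp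
  have "M powr (1 / p) \<le> real n" unfolding n_def by linarith
  then have "(M powr (1 / p)) powr p \<le> real n powr p"
    using p by (intro powr_mono2) auto
  moreover have "(M powr (1 / p)) powr p = M"
    using p M by (simp add: powr_powr)
  ultimately have "576 * K < real n powr p" unfolding M_def by linarith
  then have "576 * K * real n powr (- p) < real n powr p * real n powr (- p)"
    using n by (intro mult_strict_right_mono) auto
  also have "\<dots> = 1"
    unfolding powr_add[symmetric] using n by simp
  finally have lt: "576 * (K * real n powr (- p)) < 1" by simp
  have "1 / q - 2 = - p + (- 1)" by (simp add: p_def)
  then have "real n powr (1 / q - 2) = real n powr (- p) * real n powr (- 1)"
    by (simp only: powr_add)
  also have "real n powr (- 1) = 1 / real n" using n by (simp add: powr_minus_divide)
  finally have "K * real n powr (1 / q - 2) = K * real n powr (- p) / real n" by simp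
  also have "\<dots> < 1 / (576 * real n)"
    using lt n by (simp add: pos_divide_less_eq)
  finally show ?thesis using that[of n] by (simp add: n_def)
qed

lemma ennreal_powr_mono:
  assumes "x \<le> y" "p \<ge> 0"
  shows "ennreal_powr x p \<le> ennreal_powr y p"
proof (cases "y = \<infinity>")
  case True
  then show ?thesis by (simp add: ennreal_powr_def)
next
  case False
  then have "y < top" by (simp add: less_top[symmetric])
  then have "enn2real x powr p \<le> enn2real y powr p"
    using assms by (intro powr_mono2 enn2real_mono) auto
  moreover have "x \<noteq> \<infinity>" using False assms(1) by (auto simp: top_unique)
  ultimately show ?thesis using False by (simp add: ennreal_powr_def ennreal_leI)
qed

lemma ennreal_powr_ennreal: "x \<ge> 0 \<Longrightarrow> ennreal_powr (ennreal x) p = ennreal (x powr p)"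
  by (simp add: ennreal_powr_def)

theorem theorem9p5:
  fixes \<eta> :: "real \<Rightarrow> real" and \<alpha> :: nat and q :: real
  assumes "vp_cutoff \<eta>" and "\<alpha> \<ge> 1" and "q > 1"
  shows "\<exists>f\<in>L1_torus. \<not> (\<exists>C::real. \<forall>n::nat. n \<ge> 1 \<longrightarrow>
           modulus_smoothness \<alpha> f (2 powr - real n)
           \<le> ennreal C *
              ennreal_powr
                (\<Sum>j. let k = n + 1 + j in
                   ennreal (2 powr (- q * real \<alpha> * real k)) *
                   ennreal_powr (L1_norm (nth_derivative \<alpha> (vp_mean \<eta> (2 ^ k) f))) q)
                (1 / q))"
proof (intro bexI[OF _ lacunary_sum_in_L1_torus] notI, elim exE)
  fix C :: real
  let ?S = "\<lambda>n. \<Sum>j. let k = n + 1 + j in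
                   ennreal (2 powr (- q * real \<alpha> * real k)) *
                   ennreal_powr (L1_norm (nth_derivative \<alpha> (vp_mean \<eta> (2 ^ k) lacunary_sum))) q"
  assume C: "\<forall>n::nat. n \<ge> 1 \<longrightarrow> modulus_smoothness \<alpha> lacunary_sum (2 powr - real n)
      \<le> ennreal C * ennreal_powr (?S n) (1 / q)"
  obtain B where B: "B > 0" "\<And>k. k \<ge> 1 \<Longrightarrow>
    L1_norm (nth_derivative \<alpha> (vp_mean \<eta> (2 ^ k) lacunary_sum)) \<le> ennreal (2 ^ (\<alpha> * k) * (B / (real k + 1)\<^sup>2))"
    using vp_mean_lacunary_sum_le[OF assms(1,2)] by blast
  have term_le: "ennreal (2 powr (- q * real \<alpha> * real k)) *
      ennreal_powr (L1_norm (nth_derivative \<alpha> (vp_mean \<eta> (2 ^ k) lacunary_sum))) q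
      \<le> ennreal (B powr q * real n powr (2 - 2 * q)) * ennreal (1 / (real k)\<^sup>2)"
    if n: "n \<ge> 1" "n \<le> k" for n k
  proof -
    have k: "k \<ge> 1" using n by simp
    have "ennreal (2 powr (- q * real \<alpha> * real k)) *
        ennreal_powr (L1_norm (nth_derivative \<alpha> (vp_mean \<eta> (2 ^ k) lacunary_sum))) q
      \<le> ennreal (2 powr (- q * real \<alpha> * real k)) * ennreal_powr (ennreal (2 ^ (\<alpha> * k) * (B / (real k + 1)\<^sup>2))) q"
      using assms(3) by (intro mult_left_mono ennreal_powr_mono B k) auto
    also have "\<dots> = ennreal (2 powr (- q * real \<alpha> * real k) * (2 ^ (\<alpha> * k) * (B / (real k + 1)\<^sup>2)) powr q)"
      using B(1) by (subst ennreal_powr_ennreal) (auto simp: ennreal_mult)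
    also have "\<dots> \<le> ennreal (B powr q * real n powr (2 - 2 * q) * (1 / (real k)\<^sup>2))"
      by (intro ennreal_leI weighted_powr_le B(1) assms(3) n)
    also have "\<dots> = ennreal (B powr q * real n powr (2 - 2 * q)) * ennreal (1 / (real k)\<^sup>2)"
      by (rule ennreal_mult) auto
    finally show ?thesis .
  qed
  have S: "ennreal_powr (?S n) (1 / q) \<le> ennreal (B * real n powr (1 / q - 2))" if n: "n \<ge> 1" for n
  proof -
    \<comment> \<open>The power of n is a common factor and the tail of inverse squares adds 1/n, so
      the root is of order n^{(1-2q)/q}.\<close>
    have "?S n \<le> (\<Sum>j. ennreal (B powr q * real n powr (2 - 2 * q)) * ennreal (1 / (real (n + 1 + j))\<^sup>2))"
      unfolding Let_def by (intro suminf_le summableI term_le n) simp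
    also have "\<dots> \<le> ennreal (B powr q * real n powr (2 - 2 * q)) * ennreal (1 / real n)"
      unfolding ennreal_suminf_cmult by (intro mult_left_mono suminf_inverse_square_tail_le n) auto
    also have "\<dots> = ennreal (B powr q * real n powr (1 - 2 * q))"
      using n powr_two_minus_divide[of "real n" q]
      by (subst ennreal_mult[symmetric]) (simp_all only: mult.assoc, simp_all)
    finally have "ennreal_powr (?S n) (1 / q) \<le> ennreal_powr (ennreal (B powr q * real n powr (1 - 2 * q))) (1 / q)"
      using assms(3) by (intro ennreal_powr_mono) auto
    also have "\<dots> = ennreal ((B powr q * real n powr (1 - 2 * q)) powr (1 / q))"
      by (rule ennreal_powr_ennreal) auto
    also have "(B powr q * real n powr (1 - 2 * q)) powr (1 / q) = B * real n powr (1 / q - 2)"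
      using B(1) assms(3) n by (intro powr_product_root) auto
    finally show ?thesis .
  qed
  \<comment> \<open>A candidate C may be negative, and \<open>ennreal C\<close> is then 0;
    \<open>max C 0\<close> covers both cases. The bound n \<ge> \<alpha> + 1 gives n \<ge> 1 and
    \<alpha> \<le> 2^n.\<close>
  obtain n where n: "n \<ge> \<alpha> + 1" "max C 0 * B * real n powr (1 / q - 2) < 1 / (576 * real n)"
    using reciprocal_not_le_powr[OF assms(3)] by blast
  have n1: "n \<ge> 1" using n(1) by simp
  have "real \<alpha> \<le> real n" using n(1) by simp
  also have "\<dots> \<le> 2 ^ n" by (rule less_imp_le[OF of_nat_less_two_power])
  finally have "ennreal (1 / (576 * real n)) \<le> modulus_smoothness \<alpha> lacunary_sum (2 powr - real n)"
    by (rule modulus_smoothness_lacunary_sum_ge[OF n1])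
  also have "\<dots> \<le> ennreal C * ennreal_powr (?S n) (1 / q)"
    using C n1 by blast
  also have "\<dots> \<le> ennreal (max C 0) * ennreal (B * real n powr (1 / q - 2))"
    by (intro mult_mono S[OF n1] ennreal_leI) auto
  also have "\<dots> = ennreal (max C 0 * B * real n powr (1 / q - 2))"
    using B(1) by (subst ennreal_mult[symmetric]) (simp_all add: mult.assoc)
  finally have "1 / (576 * real n) \<le> max C 0 * B * real n powr (1 / q - 2)"
    using B(1) by (subst (asm) ennreal_le_iff) auto
  with n(2) show False by linarith
qed

end
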